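(* Let $p>3$ be a prime and let $x$ be a $p$-adic integer. Then $$\sum_{k=0}^{p-1}s_k(x)\sum_{j=0}^{p-1}\binom xj\binom{-1-x}j\binom{k+j}j\equiv\sum_{k=0}^{p-1}\binom xk\binom{-1-x}k\frac p{2k+1}\pmod{p^3}.$$
   Context: For $n\in\{0,1,2,\ldots\}$, $s_n(x)=\sum_{k=0}^n\binom nk\binom xk\binom{x+k}k$, where $\binom xk=x(x-1)\cdots(x-k+1)/k!$. For $p$-adic numbers $a,b$, $a\equiv b\pmod{p^3}$ means $(a-b)/p^3$ is a $p$-adic integer. *)

theory Defs
  imports
    "HOL-Computational_Algebra.Polynomial_Factorial"
    "Berlekamp_Zassenhaus.Finite_Field"
begin

text \<open>
  The prime \<open>p\<close> is the cardinality of the type parameter \<open>'p :: prime_card\<close>.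
  The ring of \<open>p\<close>-adic integers is the inverse limit of the rings \<open>\<int> / p^n \<int>\<close>;
  residues modulo \<open>p^n\<close> are represented by their least non-negative representatives.
\<close>

typedef (overloaded) ('p :: prime_card) padic_int =
  "{f :: nat \<Rightarrow> int. \<forall>n. f n \<in> {0..<int CARD('p) ^ n} \<and>
     f (Suc n) mod int CARD('p) ^ n = f n}"
  morphisms padic_residue Abs_padic_int
  by (rule exI[of _ "\<lambda>_. 0"]) (use prime_card[where 'a = 'p] prime_gt_0_nat in auto)

setup_lifting type_definition_padic_int

lemma padic_card_gt_0 [simp]: "int CARD('p :: prime_card) ^ n > 0"
  using prime_gt_0_nat[OF prime_card[where 'a = 'p]] by simp

lemma padic_int_eqI:
  "(\<And>n. padic_residue x n = padic_residue y n) \<Longrightarrow> x = y"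
  by (simp add: padic_residue_inject[symmetric] fun_eq_iff)

lemma padic_residue_mod_self [simp]:
  "padic_residue (x :: 'p :: prime_card padic_int) n mod int CARD('p) ^ n = padic_residue x n"
  using padic_residue[of x] by auto

lemma padic_residue_Suc_mod:
  "padic_residue (x :: 'p :: prime_card padic_int) (Suc n) mod int CARD('p) ^ n = padic_residue x n"
  using padic_residue[of x] by auto

lemma padic_residue_add_mod:
  "padic_residue (x :: 'p :: prime_card padic_int) (n + k) mod int CARD('p) ^ n = padic_residue x n"
proof (induction k)
  case (Suc k)
  have "padic_residue x (n + Suc k) mod int CARD('p) ^ n =
        padic_residue x (Suc (n + k)) mod int CARD('p) ^ (n + k) mod int CARD('p) ^ n"
    by (simp add: mod_mod_cancel le_imp_power_dvd)
  also have "\<dots> = padic_residue x n"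
    by (simp only: padic_residue_Suc_mod Suc.IH)
  finally show ?case .
qed simp

lemma padic_residues_of_int:
  assumes "\<And>n. [g (Suc n) = g n] (mod int CARD('p :: prime_card) ^ n)"
  shows "g n mod int CARD('p) ^ n \<in> {0..<int CARD('p) ^ n} \<and>
         g (Suc n) mod int CARD('p) ^ Suc n mod int CARD('p) ^ n = g n mod int CARD('p) ^ n"
  using assms[of n] by (simp add: mod_mod_cancel cong_def)

lemma padic_compatible:
  assumes "f (Suc n) mod int CARD('p :: prime_card) ^ n = f n"
  shows "[f (Suc n) = f n] (mod int CARD('p) ^ n)"
  using assms by (metis cong_def mod_mod_trivial)

instantiation padic_int :: (prime_card) comm_ring_1
begin

lift_definition zero_padic_int :: "'a padic_int" is "\<lambda>n. 0 mod int CARD('a) ^ n"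
  by (intro allI padic_residues_of_int) simp

lift_definition one_padic_int :: "'a padic_int" is "\<lambda>n. 1 mod int CARD('a) ^ n"
  by (intro allI padic_residues_of_int) simp

lift_definition plus_padic_int :: "'a padic_int \<Rightarrow> 'a padic_int \<Rightarrow> 'a padic_int"
  is "\<lambda>f g n. (f n + g n) mod int CARD('a) ^ n"
  by (intro allI padic_residues_of_int cong_add padic_compatible) auto

lift_definition minus_padic_int :: "'a padic_int \<Rightarrow> 'a padic_int \<Rightarrow> 'a padic_int"
  is "\<lambda>f g n. (f n - g n) mod int CARD('a) ^ n"
  by (intro allI padic_residues_of_int cong_diff padic_compatible) auto

lift_definition uminus_padic_int :: "'a padic_int \<Rightarrow> 'a padic_int"
  is "\<lambda>f n. (- f n) mod int CARD('a) ^ n"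
  by (intro allI padic_residues_of_int, subst cong_minus_minus_iff, intro padic_compatible) auto

lift_definition times_padic_int :: "'a padic_int \<Rightarrow> 'a padic_int \<Rightarrow> 'a padic_int"
  is "\<lambda>f g n. (f n * g n) mod int CARD('a) ^ n"
  by (intro allI padic_residues_of_int cong_mult padic_compatible) auto

lemmas padic_residue_simps =
  zero_padic_int.rep_eq one_padic_int.rep_eq plus_padic_int.rep_eq minus_padic_int.rep_eq
  uminus_padic_int.rep_eq times_padic_int.rep_eq

instance
proof
  fix a b c :: "'a padic_int"
  show "a * b * c = a * (b * c)"
    by (rule padic_int_eqI) (simp add: padic_residue_simps mod_simps mult.assoc)
  show "a * b = b * a"
    by (rule padic_int_eqI) (simp add: padic_residue_simps mult.commute)
  show "1 * a = a"
    by (rule padic_int_eqI) (simp add: padic_residue_simps mod_simps)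
  show "a + b + c = a + (b + c)"
    by (rule padic_int_eqI) (simp add: padic_residue_simps mod_simps add.assoc)
  show "a + b = b + a"
    by (rule padic_int_eqI) (simp add: padic_residue_simps add.commute)
  show "0 + a = a"
    by (rule padic_int_eqI) (simp add: padic_residue_simps)
  show "- a + a = 0"
    by (rule padic_int_eqI) (simp add: padic_residue_simps mod_simps)
  show "a - b = a + - b"
    by (rule padic_int_eqI) (simp add: padic_residue_simps mod_simps)
  show "(a + b) * c = a * c + b * c"
    by (rule padic_int_eqI) (simp add: padic_residue_simps mod_simps algebra_simps)
  have "int CARD('a) > 1"
    using prime_gt_1_nat[OF prime_card[where 'a = 'a]] by simp
  then have "padic_residue (0 :: 'a padic_int) 1 \<noteq> padic_residue 1 1"
    by (simp add: padic_residue_simps)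
  then show "(0 :: 'a padic_int) \<noteq> 1"
    by metis
qed

end

lemma padic_residue_of_nat:
  "padic_residue (of_nat k :: 'p :: prime_card padic_int) n = int k mod int CARD('p) ^ n"
  by (induction k) (simp_all add: padic_residue_simps mod_simps)

instance padic_int :: (prime_card) idom
proof
  fix a b :: "'a padic_int"
  let ?p = "int CARD('a)"
  assume "a \<noteq> 0" "b \<noteq> 0"
  then obtain m n where mn: "padic_residue a m \<noteq> 0" "padic_residue b n \<noteq> 0"
    by (metis (no_types, lifting) padic_int_eqI zero_padic_int.rep_eq mod_0)
  have "\<not> ?p ^ m dvd padic_residue a (m + n)"
    using mn(1) padic_residue_add_mod[of a m n] by (simp add: dvd_eq_mod_eq_0)
  moreover have "\<not> ?p ^ n dvd padic_residue b (m + n)"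
    using mn(2) padic_residue_add_mod[of b n m] by (simp add: dvd_eq_mod_eq_0 add.commute)
  ultimately have "\<not> ?p ^ (m + n) dvd padic_residue a (m + n) * padic_residue b (m + n)"
    using prime_elem_power_dvd_prod[of ?p "m + n" "padic_residue a (m + n)" "padic_residue b (m + n)"]
      prime_card_int[where 'a = 'a]
    by (metis nat_le_linear add_le_cancel_left add_le_cancel_right le_imp_power_dvd dvd_trans
        prime_imp_prime_elem)
  then have "padic_residue (a * b) (m + n) \<noteq> padic_residue 0 (m + n)"
    by (simp add: padic_residue_simps dvd_eq_mod_eq_0)
  then show "a * b \<noteq> 0"
    by metis
qed

instance padic_int :: (prime_card) ring_char_0
proof
  show "inj (of_nat :: nat \<Rightarrow> 'a padic_int)"
  proof (rule injI)
    fix k l :: nat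
    assume eq: "(of_nat k :: 'a padic_int) = of_nat l"
    let ?n = "k + l" and ?p = "CARD('a)"
    have "2 \<le> ?p"
      using prime_ge_2_nat[OF prime_card[where 'a = 'a]] .
    then have "?n < ?p ^ ?n"
      by (meson less_exp order_less_le_trans power_mono zero_le)
    then have "k < ?p ^ ?n" "l < ?p ^ ?n"
      by linarith+
    moreover have "int k mod int ?p ^ ?n = int l mod int ?p ^ ?n"
      using eq padic_residue_of_nat by metis
    then have "k mod ?p ^ ?n = l mod ?p ^ ?n"
      by (metis of_nat_eq_iff of_nat_power zmod_int)
    ultimately show "k = l"
      by simp
  qed
qed

instance fract :: ("{idom, ring_char_0}") field_char_0
proof
  show "inj (of_nat :: nat \<Rightarrow> 'a fract)"
    by (rule injI) (simp add: of_nat_fract eq_fract)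
qed

type_synonym 'p padic = "'p padic_int fract"

definition padic_ints :: "'p :: prime_card padic set" where
  "padic_ints = range to_fract"

definition padic_cong :: "'p :: prime_card padic \<Rightarrow> 'p padic \<Rightarrow> 'p padic \<Rightarrow> bool"
    (\<open>(1[_ = _] '(pmod _'))\<close>) where
  "[a = b] (pmod m) \<longleftrightarrow> (a - b) / m \<in> padic_ints"

definition s_poly :: "nat \<Rightarrow> 'a :: field_char_0 \<Rightarrow> 'a" where
  "s_poly n x = (\<Sum>k=0..n. of_nat (n choose k) * (x gchoose k) * ((x + of_nat k) gchoose k))"

end

theory Submission
  imports Defs
begin

text \<open>
  Put \<open>b i x = binom(x, i) binom(x + i, i)\<close>, so that
  \<open>binom(x, i) binom(-1 - x, i) = (-1)^i b i x\<close>. Products linearise as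
  \<open>b i x * b j x = (\<Sum>m. binom(i + j, m) binom(m, i) binom(m, j) b m x)\<close>, which turns the left-hand
  side into \<open>\<Sum>m<2p. D m * b m x\<close> with integers \<open>D m\<close>; the congruence holds for each
  coefficient separately.

  For \<open>m \<ge> p\<close> every summand of \<open>D m\<close> contains three binomial coefficients divisible by \<open>p\<close>.

  For \<open>m < p\<close>, \<open>(-1)^m D m = (\<Sum>k<p. E m k)\<close> where
  \<open>E m k = (\<Sum>r. (binom(m, r) binom(k + m - r, m))^2) = (\<Sum>i. b i m * b i k)\<close>; the two sums agree
  because both satisfy the same Apery-like second-order recurrence in \<open>k\<close>. Since
  \<open>(\<Sum>k<p. b i k) = p / (2i + 1) * binom(p - 1, i) binom(p + i, i)\<close> and
  \<open>(\<Sum>i. (-1)^i b i m / (2i + 1)) = 1 / (2m + 1)\<close>, it remains to see that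
  \<open>binom(p - 1, i) binom(p + i, i)\<close> is \<open>(-1)^i\<close> modulo \<open>p^2\<close>, and even modulo \<open>p^3\<close> in the case
  \<open>2i + 1 = p\<close>, where the denominator absorbs a factor \<open>p\<close>. The latter holds because
  \<open>\<Sum>r<p/2. 1 / r^2\<close> vanishes modulo \<open>p\<close> for \<open>p > 3\<close>.
\<close>

section \<open>Reciprocal factorials on all integers\<close>

text \<open>With \<open>1 / n! = 0\<close> for negative \<open>n\<close>, contiguity relations between hypergeometric terms need no
  side conditions at the boundary of their support.\<close>

definition rfact :: "int \<Rightarrow> 'a :: field_char_0" where
  "rfact n = (if n < 0 then 0 else inverse (fact (nat n)))"

lemma rfact_rec: "rfact (n - 1) = of_int n * (rfact n :: 'a :: field_char_0)"
proof (cases "n \<le> 0")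
  case True
  then show ?thesis by (cases "n = 0") (auto simp: rfact_def)
next
  case False
  then obtain k where "n = int (Suc k)"
    by (metis gr0_implies_Suc not_le zero_less_imp_eq_int)
  moreover from this have "nat (n - 1) = k" by simp
  ultimately show ?thesis by (simp add: rfact_def del: of_nat_Suc)
qed

text \<open>Index and factor enter through equations, so that an index of any shape matches.\<close>

lemma rfact_dec:
  "n = k - 1 \<Longrightarrow> z = of_int k \<Longrightarrow> rfact n = z * (rfact k :: 'a :: field_char_0)"
  by (simp add: rfact_rec)

text \<open>For k > n both sides vanish, the right one through a negative argument of
  \<open>rfact\<close>.\<close>

lemma of_nat_choose_rfact:
  "(of_nat (n choose k) :: 'a :: field_char_0) = fact n * rfact (int k) * rfact (int n - int k)"
proof (cases "k \<le> n")
  case True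
  then show ?thesis by (simp add: rfact_def binomial_fact field_simps flip: of_nat_diff)
qed (simp add: rfact_def)

subsection \<open>The basis of products of binomial coefficients\<close>

text \<open>This is \<open>b i x\<close> of the overview; as a polynomial in x it depends only on x
  (x + 1).\<close>

definition lbin :: "nat \<Rightarrow> 'a :: field_char_0 \<Rightarrow> 'a" where
  "lbin i x = (x gchoose i) * ((x + of_nat i) gchoose i)"

lemma lbin_0 [simp]: "lbin 0 x = 1"
  by (simp add: lbin_def)

lemma lbin_pochhammer:
  "lbin i x = (- 1) ^ i * pochhammer (- x) i * pochhammer (x + 1) i / (fact i)\<^sup>2"
  by (simp add: lbin_def gbinomial_pochhammer[of x] gbinomial_pochhammer'[of "x + of_nat i"]
      power2_eq_square)

text \<open>The new factors combine to (x - i)(x + i + 1) = x (x + 1) - i (i + 1).\<close>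

lemma lbin_Suc:
  "(of_nat (Suc i))\<^sup>2 * lbin (Suc i) x = (x * (x + 1) - of_nat (i * Suc i)) * lbin i x"
proof -
  have "(of_nat (Suc i) :: 'a) \<noteq> 0" by (simp del: of_nat_Suc)
  moreover have "(- 1) ^ Suc i * pochhammer (- x) (Suc i) * pochhammer (x + 1) (Suc i)
      = (x * (x + 1) - of_nat (i * Suc i)) * ((- 1) ^ i * pochhammer (- x) i * pochhammer (x + 1) i)"
    by (simp add: pochhammer_Suc algebra_simps)
  ultimately show ?thesis
    unfolding lbin_pochhammer fact_Suc of_nat_mult power_mult_distrib
    by (simp add: field_simps)
qed

lemma lbin_of_nat:
  "lbin i (of_nat n) = of_nat ((n choose i) * ((n + i) choose i))"
  by (simp add: lbin_def binomial_gbinomial)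

lemma lbin_of_nat_eq_0: "n < i \<Longrightarrow> lbin i (of_nat n) = 0"
  by (simp add: lbin_of_nat)

lemma lbin_of_nat_rfact:
  "lbin i (of_nat n) = fact (n + i) * rfact (int n - int i) * (rfact (int i))\<^sup>2"
proof -
  have "fact n * rfact (int n) = (1 :: 'a)" by (simp add: rfact_def)
  then show ?thesis
    by (simp add: lbin_of_nat of_nat_choose_rfact power2_eq_square mult.assoc mult.left_commute)
qed

text \<open>Induction on i: up to a constant, multiplying \<open>lbin i x\<close> by x (x + 1) - i
  (i + 1) raises i by one. On the right this factor is split into x (x + 1) - m (m + 1), which
  raises m, and a constant; comparing coefficients leaves a recurrence for the triple product of
  binomials.\<close>

lemma lbin_mult:
  "lbin i x * lbin j x =
    (\<Sum>m\<le>i + j. of_nat (((i + j) choose m) * (m choose i) * (m choose j)) * lbin m x)"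
proof (induction i)
  case 0
  have "(\<Sum>m\<le>j. of_nat ((j choose m) * (m choose j)) * lbin m x) =
      (\<Sum>m\<in>{j}. of_nat ((j choose m) * (m choose j)) * lbin m x)"
    by (rule sum.mono_neutral_right) auto
  then show ?case by simp
next
  case (Suc i)
  define c :: "nat \<Rightarrow> nat \<Rightarrow> 'a"
    where "c i m = of_nat (((i + j) choose m) * (m choose i) * (m choose j))" for i m
  have c_rfact: "c i m = fact (i + j) * fact m * rfact (int i) * rfact (int j) *
      rfact (int i + int j - int m) * rfact (int m - int i) * rfact (int m - int j)" for i m
  proof -
    have "fact m * rfact (int m) = (1 :: 'a)" by (simp add: rfact_def)
    then show ?thesis
      by (simp add: c_def of_nat_choose_rfact algebra_simps)
  qed
  have rec: "(of_nat (Suc i))\<^sup>2 * c (Suc i) (Suc m) = (of_nat (Suc m))\<^sup>2 * c i m +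
      (of_nat (Suc m * Suc (Suc m)) - of_nat (i * Suc i)) * c i (Suc m)" for m
  proof -
    \<comment> \<open>\<open>A\<close> is a common factor of the three coefficients, which turns
      \<open>rec\<close> into a polynomial identity.\<close>
    define A :: 'a where "A = fact (i + j) * fact m * rfact (int i + 1) * rfact (int j) *
       rfact (int i + int j - int m) * rfact (int m + 1 - int i) * rfact (int m + 1 - int j)"
    have e: "rfact (int i) = (of_nat i + 1) * (rfact (int i + 1) :: 'a)"
      "rfact (int m - int i) = (of_nat m + 1 - of_nat i) * (rfact (int m + 1 - int i) :: 'a)"
      "rfact (int m - int j) = (of_nat m + 1 - of_nat j) * (rfact (int m + 1 - int j) :: 'a)"
      "rfact (int i + int j - int (Suc m)) =
        (of_nat i + of_nat j - of_nat m) * (rfact (int i + int j - int m) :: 'a)"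
      by (rule rfact_dec; simp)+
    have e': "rfact (int (Suc m) - int i) = (rfact (int m + 1 - int i) :: 'a)"
      "rfact (int (Suc m) - int j) = (rfact (int m + 1 - int j) :: 'a)"
      "rfact (int (Suc i)) = (rfact (int i + 1) :: 'a)"
      "rfact (int (Suc m) - int (Suc i)) = (rfact (int m - int i) :: 'a)"
      "rfact (int (Suc i) + int j - int (Suc m)) = (rfact (int i + int j - int m) :: 'a)"
      by (simp_all add: algebra_simps)
    have c1: "c (Suc i) (Suc m) = (of_nat i + of_nat j + 1) * (of_nat m + 1) * (of_nat m + 1 - of_nat i) * A"
      unfolding c_rfact A_def e' e by (simp add: algebra_simps)
    have c2: "c i (Suc m) =
        (of_nat m + 1) * (of_nat i + 1) * (of_nat i + of_nat j - of_nat m) * A"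
      unfolding c_rfact A_def e' e by (simp add: algebra_simps)
    have c3: "c i m = (of_nat i + 1) * (of_nat m + 1 - of_nat i) * (of_nat m + 1 - of_nat j) * A"
      unfolding c_rfact A_def e by (simp add: algebra_simps)
    show ?thesis
      unfolding c1 c2 c3 by (simp add: algebra_simps power2_eq_square)
  qed
  \<comment> \<open>Both sides are 0, since binom(0, i + 1) = 0 and i binom(0, i) = 0.\<close>
  have c0: "(of_nat (Suc i))\<^sup>2 * c (Suc i) 0 = - of_nat (i * Suc i) * c i 0"
    by (cases i) (simp_all add: c_def)
  \<comment> \<open>Allows one more term in the second sum below, so that shifting its index aligns
    the two sums.\<close>
  have top: "c i (Suc (i + j)) = 0" by (simp add: c_def)
  have "(of_nat (Suc i))\<^sup>2 * (lbin (Suc i) x * lbin j x) =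
      (x * (x + 1) - of_nat (i * Suc i)) * (lbin i x * lbin j x)"
    by (simp only: mult.assoc[symmetric] lbin_Suc)
  also have "\<dots> = (\<Sum>m\<le>i + j. c i m * ((x * (x + 1) - of_nat (i * Suc i)) * lbin m x))"
    unfolding Suc.IH sum_distrib_left c_def by (simp only: ac_simps)
  also have "\<dots> = (\<Sum>m\<le>i + j. c i m * (of_nat (Suc m))\<^sup>2 * lbin (Suc m) x +
      c i m * (of_nat (m * Suc m) - of_nat (i * Suc i)) * lbin m x)"
  proof (rule sum.cong)
    fix m
    show "c i m * ((x * (x + 1) - of_nat (i * Suc i)) * lbin m x) =
      c i m * (of_nat (Suc m))\<^sup>2 * lbin (Suc m) x +
      c i m * (of_nat (m * Suc m) - of_nat (i * Suc i)) * lbin m x"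
      by (simp only: mult.assoc lbin_Suc) (simp add: algebra_simps)
  qed simp
  also have "\<dots> = (\<Sum>m\<le>i + j. c i m * (of_nat (Suc m))\<^sup>2 * lbin (Suc m) x) +
      (\<Sum>m\<le>Suc (i + j). c i m * (of_nat (m * Suc m) - of_nat (i * Suc i)) * lbin m x)"
    by (simp add: sum.distrib top)
  also have "\<dots> = - of_nat (i * Suc i) * c i 0 + (\<Sum>m\<le>i + j. ((of_nat (Suc m))\<^sup>2 * c i m +
      (of_nat (Suc m * Suc (Suc m)) - of_nat (i * Suc i)) * c i (Suc m)) * lbin (Suc m) x)"
    unfolding sum.atMost_Suc_shift distrib_right sum.distrib
    by (simp add: ac_simps del: of_nat_Suc of_nat_mult mult_Suc mult_Suc_right)
  also have "\<dots> = (of_nat (Suc i))\<^sup>2 * (\<Sum>m\<le>Suc (i + j). c (Suc i) m * lbin m x)"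
    unfolding rec[symmetric] c0[symmetric] sum.atMost_Suc_shift
    by (simp add: sum_distrib_left algebra_simps)
  finally show ?case
    unfolding c_def by (simp only: mult_cancel_left power_eq_0_iff of_nat_eq_0_iff add_Suc) simp
qed

subsection \<open>A double binomial sum as a sum of squares\<close>

text \<open>The left side is the m-th forward difference of binom(y, l) as a function of y, and by
  Pascal's rule each difference lowers l by one.\<close>

lemma alternating_choose_sum:
  "(\<Sum>j\<le>m. (- 1) ^ (m + j) * int (m choose j) * int ((y + j) choose l)) =
    (if l < m then 0 else int (y choose (l - m)))"
proof (induction m arbitrary: y)
  case (Suc m)
  have "(\<Sum>j\<le>Suc m. (- 1) ^ (Suc m + j) * int (Suc m choose j) * int ((y + j) choose l)) =
     (\<Sum>j\<le>Suc m. (- 1) ^ (Suc m + j) * int (m choose j) * int ((y + j) choose l)) +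
     (\<Sum>j\<le>m. (- 1) ^ (Suc m + Suc j) * int (m choose j) * int ((y + Suc j) choose l))"
    unfolding sum.atMost_Suc_shift[of _ m]
    by (simp add: sum.distrib[symmetric] algebra_simps)
  also have "\<dots> = (\<Sum>j\<le>m. (- 1) ^ (m + j) * int (m choose j) * int ((Suc y + j) choose l)) -
      (\<Sum>j\<le>m. (- 1) ^ (m + j) * int (m choose j) * int ((y + j) choose l))"
    by (simp add: sum_negf algebra_simps)
  also have "\<dots> = (if l < Suc m then 0 else int (y choose (l - Suc m)))"
  proof -
    consider "l < m" | "l = m" | d where "l = Suc (m + d)"
      by (metis less_iff_Suc_add linorder_neqE_nat)
    then show ?thesis
      unfolding Suc.IH by cases auto
  qed
  finally show ?case .
qed simp

text \<open>Both sides are (k + j)! / (k! l! (j - l)!) for l \<le> j and 0 otherwise.\<close>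

lemma choose_mult_choose_shift:
  "(j choose l) * ((k + j) choose j) = ((k + j) choose (k + l)) * ((k + l) choose l)"
proof (cases "l \<le> j")
  case True
  have "((k + j) choose j) * (j choose l) = ((k + j) choose l) * ((k + j - l) choose (j - l))"
    by (rule choose_mult) (use True in auto)
  moreover have "((k + j) choose (k + l)) * ((k + l) choose l) =
      ((k + j) choose l) * ((k + j - l) choose (k + l - l))"
    by (rule choose_mult) (use True in auto)
  moreover have "(k + j - l) choose (j - l) = (k + j - l) choose (k + l - l)"
    using binomial_symmetric[of "j - l" "k + j - l"] True by simp
  ultimately show ?thesis by (simp add: mult.commute)
qed (simp add: binomial_eq_0)

text \<open>Vandermonde splits binom(i + j, m); \<open>choose_mult_choose_shift\<close> then leaves
  j in a single binomial besides the weight binom(m, j), and the sum over j becomes an m-th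
  difference.\<close>

lemma alternating_choose_sum2:
  "(\<Sum>j\<le>m. (- 1) ^ (m + j) * int (((i + j) choose m) * (m choose j) * ((k + j) choose j))) =
    (\<Sum>r\<le>m. int ((i choose r) * (k choose r) * ((k + (m - r)) choose k)))"
proof -
  have "(\<Sum>j\<le>m. (- 1) ^ (m + j) * int (((i + j) choose m) * (m choose j) * ((k + j) choose j))) =
     (\<Sum>j\<le>m. \<Sum>r\<le>m. int ((i choose r) * ((k + (m - r)) choose k)) *
        ((- 1) ^ (m + j) * int (m choose j) * int ((k + j) choose (k + (m - r)))))"
  proof (rule sum.cong)
    fix j
    have "((i + j) choose m) * ((k + j) choose j) =
        (\<Sum>r\<le>m. (i choose r) * ((j choose (m - r)) * ((k + j) choose j)))"
      unfolding vandermonde[symmetric] sum_distrib_right by (simp only: mult.assoc)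
    also have "\<dots> = (\<Sum>r\<le>m. (i choose r) * ((k + (m - r)) choose k) * ((k + j) choose (k + (m - r))))"
      unfolding choose_mult_choose_shift
      by (rule sum.cong) (simp_all only: binomial_symmetric[of k "k + (m - r)" for r] le_add1
          diff_add_inverse ac_simps)
    finally have "int (((i + j) choose m) * ((k + j) choose j)) =
       (\<Sum>r\<le>m. int ((i choose r) * ((k + (m - r)) choose k) * ((k + j) choose (k + (m - r)))))"
      by (simp only: of_nat_sum)
    then have "(- 1) ^ (m + j) * int (m choose j) * int (((i + j) choose m) * ((k + j) choose j)) =
      (- 1) ^ (m + j) * int (m choose j) *
       (\<Sum>r\<le>m. int ((i choose r) * ((k + (m - r)) choose k) * ((k + j) choose (k + (m - r)))))"
      by (simp only:)
    then show "(- 1) ^ (m + j) * int (((i + j) choose m) * (m choose j) * ((k + j) choose j)) =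
       (\<Sum>r\<le>m. int ((i choose r) * ((k + (m - r)) choose k)) *
        ((- 1) ^ (m + j) * int (m choose j) * int ((k + j) choose (k + (m - r)))))"
      unfolding sum_distrib_left by (simp add: ac_simps)
  qed simp
  also have "\<dots> = (\<Sum>r\<le>m. int ((i choose r) * ((k + (m - r)) choose k)) *
      (if k + (m - r) < m then 0 else int (k choose (k + (m - r) - m))))"
    by (subst sum.swap) (simp only: sum_distrib_left[symmetric] alternating_choose_sum)
  also have "\<dots> = (\<Sum>r\<le>m. int ((i choose r) * (k choose r) * ((k + (m - r)) choose k)))"
  proof (rule sum.cong)
    fix r assume "r \<in> {..m}"
    \<comment> \<open>The default 0 occurs exactly for k < r, where binom(k, r) is 0 too.\<close>
    then have "(if k + (m - r) < m then 0 else int (k choose (k + (m - r) - m))) = int (k choose r)"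
      using binomial_symmetric[of r k] by (auto simp: not_less)
    then show "int ((i choose r) * ((k + (m - r)) choose k)) *
      (if k + (m - r) < m then 0 else int (k choose (k + (m - r) - m))) =
      int ((i choose r) * (k choose r) * ((k + (m - r)) choose k))"
      by simp
  qed simp
  finally show ?thesis .
qed

text \<open>Trinomial revision turns binom(m, i) binom(i, r) into binom(m, r) binom(m - r, m - i);
  the rest is Vandermonde.\<close>

lemma choose_triple_sum:
  assumes "r \<le> m"
  shows "(\<Sum>i\<le>m. (m choose i) * (k choose i) * (i choose r)) = (m choose r) * ((k + (m - r)) choose m)"
proof -
  have "(\<Sum>i\<le>m. (m choose i) * (k choose i) * (i choose r)) =
      (\<Sum>i\<in>{r..m}. (m choose r) * ((k choose i) * ((m - r) choose (m - i))))"
  proof (rule sum.mono_neutral_cong_right)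
    fix i assume "i \<in> {r..m}"
    then have "(m choose i) * (i choose r) = (m choose r) * ((m - r) choose (i - r))"
      by (intro choose_mult) auto
    moreover have "(m - r) choose (i - r) = (m - r) choose (m - i)"
      by (subst binomial_symmetric) (use \<open>i \<in> {r..m}\<close> in auto)
    ultimately show "(m choose i) * (k choose i) * (i choose r) =
        (m choose r) * ((k choose i) * ((m - r) choose (m - i)))"
      by (simp add: ac_simps)
  qed auto
  also have "\<dots> = (m choose r) * (\<Sum>i\<in>{r..m}. (k choose i) * ((m - r) choose (m - i)))"
    by (simp only: sum_distrib_left)
  also have "(\<Sum>i\<in>{r..m}. (k choose i) * ((m - r) choose (m - i))) =
      (\<Sum>i\<le>m. (k choose i) * ((m - r) choose (m - i)))"
    by (rule sum.mono_neutral_left) (use assms in auto)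
  finally show ?thesis by (simp only: vandermonde)
qed

text \<open>Both sides are (k + m - r)! / (r! (k - r)! (m - r)!), which is symmetric in k and m, or
  0 for r > k.\<close>

lemma choose_product_swap:
  assumes "r \<le> m"
  shows "(k choose r) * ((k + (m - r)) choose k) = (m choose r) * ((k + (m - r)) choose m)"
proof -
  have "(of_nat ((k choose r) * ((k + (m - r)) choose k)) :: rat) =
     of_nat ((m choose r) * ((k + (m - r)) choose m))"
    unfolding of_nat_mult of_nat_choose_rfact using assms
    by (simp add: rfact_def of_nat_diff add.commute)
  then show ?thesis by (simp only: of_nat_eq_iff)
qed

text \<open>Summing first over j and then over i produces two products of binomials that agree by
  \<open>choose_product_swap\<close>; hence the squares.\<close>

lemma alternating_double_sum:
  "(\<Sum>i\<le>m. \<Sum>j\<le>m. (- 1) ^ (m + j) *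
      int ((k choose i) * ((k + j) choose j) * (((i + j) choose m) * (m choose i) * (m choose j)))) =
    (\<Sum>r\<le>m. (int ((m choose r) * ((k + (m - r)) choose m)))\<^sup>2)"
proof -
  have "(\<Sum>i\<le>m. \<Sum>j\<le>m. (- 1) ^ (m + j) *
      int ((k choose i) * ((k + j) choose j) * (((i + j) choose m) * (m choose i) * (m choose j)))) =
    (\<Sum>i\<le>m. int ((m choose i) * (k choose i)) * (\<Sum>j\<le>m. (- 1) ^ (m + j) *
      int (((i + j) choose m) * (m choose j) * ((k + j) choose j))))"
    unfolding sum_distrib_left by (simp add: ac_simps)
  also have "\<dots> = (\<Sum>i\<le>m. \<Sum>r\<le>m. int ((k choose r) * ((k + (m - r)) choose k)) *
      int ((m choose i) * (k choose i) * (i choose r)))"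
    unfolding alternating_choose_sum2 sum_distrib_left by (simp add: ac_simps)
  also have "\<dots> = (\<Sum>r\<le>m. int ((k choose r) * ((k + (m - r)) choose k)) *
      int (\<Sum>i\<le>m. (m choose i) * (k choose i) * (i choose r)))"
    by (subst sum.swap) (simp only: sum_distrib_left of_nat_sum)
  also have "\<dots> = (\<Sum>r\<le>m. (int ((m choose r) * ((k + (m - r)) choose m)))\<^sup>2)"
  proof (rule sum.cong)
    fix r assume "r \<in> {..m}"
    then have "r \<le> m" by simp
    show "int ((k choose r) * ((k + (m - r)) choose k)) *
      int (\<Sum>i\<le>m. (m choose i) * (k choose i) * (i choose r)) =
      (int ((m choose r) * ((k + (m - r)) choose m)))\<^sup>2"
      unfolding choose_triple_sum[OF \<open>r \<le> m\<close>] choose_product_swap[OF \<open>r \<le> m\<close>, of k]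
      by (simp only: power2_eq_square)
  qed simp
  finally show ?thesis .
qed

subsection \<open>The Apery-like recurrence\<close>

text \<open>This is the forward difference of (k + 1)^3 (f (k + 1) - f k). Both sums below solve
  \<open>apery_op f k\<close> = 2 (2 k + 3) m (m + 1) f (k + 1); as (k + 2)^3 never vanishes, two
  initial values fix a solution.\<close>

definition apery_op :: "(nat \<Rightarrow> 'a :: field_char_0) \<Rightarrow> nat \<Rightarrow> 'a" where
  "apery_op f k = (of_nat k + 2) ^ 3 * (f (k + 2) - f (k + 1)) - (of_nat k + 1) ^ 3 * (f (k + 1) - f k)"

text \<open>All terms are polynomial multiples of one factor \<open>A\<close>. For i = 0 the
  truncated index i - 1 does no harm, being multiplied by i^2.\<close>

lemma apery_op_lbin:
  "apery_op (\<lambda>k. lbin i (of_nat k)) k = 2 * (2 * of_nat k + 3) *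
    (of_nat i ^ 2 * lbin (i - 1) (of_nat (k + 1)) + of_nat i * (of_nat i + 1) *
      (lbin i (of_nat (k + 1)) :: 'a :: field_char_0))"
proof -
  define K I :: 'a where "K = of_nat k" and "I = of_nat i"
  define A :: 'a where "A = fact (k + i) * rfact (int k + 2 - int i) * (rfact (int i))\<^sup>2"
  have e: "rfact (int k + 1 - int i) = (K + 2 - I) * (rfact (int k + 2 - int i) :: 'a)"
      "rfact (int k - int i) = (K + 1 - I) * (rfact (int k + 1 - int i) :: 'a)"
    by (rule rfact_dec; simp add: K_def I_def)+
  have e': "int (k + 2) - int i = int k + 2 - int i" "int (k + 1) - int i = int k + 1 - int i"
    by simp_all
  have l2: "lbin i (of_nat (k + 2)) = (K + I + 2) * (K + I + 1) * A"
    unfolding lbin_of_nat_rfact e' A_def by (simp add: K_def I_def algebra_simps)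
  have l1: "lbin i (of_nat (k + 1)) = (K + I + 1) * (K + 2 - I) * A"
    unfolding lbin_of_nat_rfact e' A_def e(1) by (simp add: K_def I_def algebra_simps)
  have l0: "lbin i (of_nat k) = (K + 1 - I) * (K + 2 - I) * A"
    unfolding lbin_of_nat_rfact e' A_def e by (simp add: K_def I_def algebra_simps)
  have l': "I ^ 2 * lbin (i - 1) (of_nat (k + 1)) = I ^ 4 * A"
  proof (cases i)
    case (Suc j)
    have "rfact (int j) = I * (rfact (int i) :: 'a)"
      by (rule rfact_dec) (simp_all add: Suc I_def)
    then show ?thesis
      unfolding lbin_of_nat_rfact A_def
      by (simp add: Suc algebra_simps power2_eq_square power4_eq_xxxx)
  qed (simp add: I_def)
  show ?thesis
    unfolding apery_op_def l2 l1 l0 l'[unfolded I_def] unfolding K_def[symmetric] I_def[symmetric]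
    by (simp add: algebra_simps power2_eq_square power3_eq_cube power4_eq_xxxx)
qed

text \<open>Shifting the index in the terms with \<open>lbin (i - 1)\<close> and applying
  \<open>lbin_Suc\<close> at x = m produces m (m + 1) - i (i + 1); the parts with i (i + 1)
  cancel.\<close>

lemma apery_op_lbin_sum:
  "apery_op (\<lambda>k. \<Sum>i\<le>m. lbin i (of_nat m) * lbin i (of_nat k)) k =
    2 * (2 * of_nat k + 3) * of_nat m * (of_nat m + 1) *
    (\<Sum>i\<le>m. lbin i (of_nat m) * (lbin i (of_nat (k + 1)) :: 'a :: field_char_0))"
proof -
  define g :: "nat \<Rightarrow> 'a" where "g i = lbin i (of_nat (k + 1))" for i
  define f :: "nat \<Rightarrow> 'a" where "f i = lbin i (of_nat m)" for i
  define M :: 'a where "M = of_nat m"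
  have f_Suc: "f (Suc i) * (of_nat (Suc i)) ^ 2 = (M * (M + 1) - of_nat i * (of_nat i + 1)) * f i" for i
    using lbin_Suc[of i "of_nat m :: 'a"] unfolding f_def M_def by (simp add: algebra_simps)
  have "(\<Sum>i\<le>m. f i * (of_nat i ^ 2 * g (i - 1))) = (\<Sum>i\<le>Suc m. f i * (of_nat i ^ 2 * g (i - 1)))"
    using lbin_of_nat_eq_0[of m "Suc m", where 'a = 'a] by (simp add: f_def)
  also have "\<dots> = (\<Sum>i\<le>m. f (Suc i) * (of_nat (Suc i)) ^ 2 * g i)"
    unfolding sum.atMost_Suc_shift by (simp add: mult.assoc)
  also have "\<dots> = (\<Sum>i\<le>m. M * (M + 1) * (f i * g i) - f i * (of_nat i * (of_nat i + 1) * g i))"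
    unfolding f_Suc by (simp add: algebra_simps)
  finally have "(\<Sum>i\<le>m. f i * (of_nat i ^ 2 * g (i - 1) + of_nat i * (of_nat i + 1) * g i)) =
      M * (M + 1) * (\<Sum>i\<le>m. f i * g i)"
    by (simp only: sum_subtractf sum_distrib_left[symmetric] distrib_left sum.distrib) simp
  moreover have "apery_op (\<lambda>k. \<Sum>i\<le>m. lbin i (of_nat m) * lbin i (of_nat k)) k =
      (\<Sum>i\<le>m. f i * apery_op (\<lambda>k. lbin i (of_nat k)) k)"
    unfolding apery_op_def f_def
    by (simp add: sum_distrib_left sum_subtractf[symmetric] algebra_simps)
  moreover have "\<dots> = 2 * (2 * of_nat k + 3) *
      (\<Sum>i\<le>m. f i * (of_nat i ^ 2 * g (i - 1) + of_nat i * (of_nat i + 1) * g i))"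
    unfolding apery_op_lbin g_def sum_distrib_left by (simp only: ac_simps)
  ultimately show ?thesis by (simp only: g_def f_def M_def mult.assoc)
qed

text \<open>Creative telescoping: \<open>V\<close> is the polynomial solution of Gosper's equation for the recurrence.\<close>

lemma apery_op_choose_sum:
  "apery_op (\<lambda>k. \<Sum>r\<le>m. (of_nat ((m choose r) * ((k + (m - r)) choose m)))\<^sup>2) k =
    2 * (2 * of_nat k + 3) * of_nat m * (of_nat m + 1) *
    (\<Sum>r\<le>m. (of_nat ((m choose r) * ((k + 1 + (m - r)) choose m)) :: 'a :: field_char_0)\<^sup>2)"
proof -
  define F :: "nat \<Rightarrow> nat \<Rightarrow> 'a"
    where "F k r = (of_nat ((m choose r) * ((k + (m - r)) choose m)))" for k r
  \<comment> \<open>\<open>N\<close> is a common factor of the summands for k, k + 1 and k +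
    2.\<close>
  define N :: "nat \<Rightarrow> 'a"
    where "N r = fact (k + (m - r)) * rfact (int r) * rfact (int k + 2 - int r) * rfact (int m - int r)" for r
  define K M :: 'a where "K = of_nat k + 1" and "M = of_nat m"
  define V :: "'a \<Rightarrow> 'a" where "V r = (2 * (3 * M + 1) * K + 2 * M ^ 2 + 6 * M + 2) * r - (2 * M + 1) * r ^ 2
    - ((4 * M + 1) * K ^ 2 + (3 * M ^ 2 + 8 * M + 2) * K + 3 * M ^ 2 + 4 * M + 1)" for r
  \<comment> \<open>The telescoping certificate: it vanishes at r = 0 by the factor r, and at r = m
    + 1 because \<open>N\<close> contains \<open>rfact (m - r)\<close>.\<close>
  define G where "G r = (of_nat r * (K + M - of_nat r) * N r)\<^sup>2 * V (of_nat r)" for r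
  have F_rfact: "F k r = fact (k + (m - r)) * rfact (int r) * rfact (int m - int r) * rfact (int k - int r)"
    if "r \<le> m" for k r
  proof -
    have "fact m * rfact (int m) = (1 :: 'a)" by (simp add: rfact_def)
    then show ?thesis using that
      unfolding F_def of_nat_mult of_nat_choose_rfact by (simp add: of_nat_diff algebra_simps)
  qed
  have step: "(K + 1) ^ 3 * ((F (k + 2) r)\<^sup>2 - (F (k + 1) r)\<^sup>2) - K ^ 3 * ((F (k + 1) r)\<^sup>2 - (F k r)\<^sup>2)
      - 2 * (2 * K + 1) * M * (M + 1) * (F (k + 1) r)\<^sup>2 = G (Suc r) - G r" if "r \<le> m" for r
  proof -
    define R :: 'a where "R = of_nat r"
    have mr: "of_nat (m - r) = M - R" using that by (simp add: M_def R_def of_nat_diff)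
    have e: "rfact (int k + 1 - int r) = (K + 1 - R) * (rfact (int k + 2 - int r) :: 'a)"
      "rfact (int k - int r) = (K - R) * (rfact (int k + 1 - int r) :: 'a)"
      by (rule rfact_dec; simp add: K_def R_def)+
    have e': "int (k + 2) - int r = int k + 2 - int r" "int (k + 1) - int r = int k + 1 - int r"
      by simp_all
    have F2: "F (k + 2) r = (K + M + 1 - R) * (K + M - R) * N r"
      unfolding F_rfact[OF that] N_def e' by (simp add: mr K_def algebra_simps)
    have F1: "F (k + 1) r = (K + M - R) * (K + 1 - R) * N r"
      unfolding F_rfact[OF that] N_def e' e(1) by (simp add: mr K_def algebra_simps)
    have F0: "F k r = (K + 1 - R) * (K - R) * N r"
      unfolding F_rfact[OF that] N_def e by (simp add: algebra_simps)
    \<comment> \<open>For r = m the difference m - Suc r is truncated, so this case is separate;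
      both sides are then 0.\<close>
    have "of_nat (Suc r) * (K + M - of_nat (Suc r)) * N (Suc r) = (K + 1 - R) * (M - R) * N r"
    proof (cases "r = m")
      case True
      then show ?thesis by (simp add: N_def rfact_def R_def M_def)
    next
      case False
      with that have r: "m - r = Suc (m - Suc r)" by simp
      have f: "fact (k + (m - r)) = (K + M - of_nat (Suc r)) * (fact (k + (m - Suc r)) :: 'a)"
        using that False by (simp add: r K_def M_def of_nat_diff algebra_simps)
      have "rfact (int r) = of_nat (Suc r) * (rfact (int (Suc r)) :: 'a)"
        "rfact (int k + 2 - int (Suc r)) = (K + 1 - R) * (rfact (int k + 2 - int r) :: 'a)"
        "rfact (int m - int (Suc r)) = (M - R) * (rfact (int m - int r) :: 'a)"
        by (rule rfact_dec; simp add: K_def R_def M_def)+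
      then show ?thesis unfolding N_def f by (simp only: ac_simps)
    qed
    then have GS: "G (Suc r) = ((K + 1 - R) * (M - R) * N r)\<^sup>2 * V (R + 1)"
      unfolding G_def by (simp add: R_def add.commute)
    show ?thesis
      unfolding F2 F1 F0 GS unfolding G_def R_def[symmetric] V_def
      by (simp add: algebra_simps power2_eq_square power3_eq_cube)
  qed
  have "(\<Sum>r\<le>m. (K + 1) ^ 3 * ((F (k + 2) r)\<^sup>2 - (F (k + 1) r)\<^sup>2) - K ^ 3 * ((F (k + 1) r)\<^sup>2 - (F k r)\<^sup>2)
      - 2 * (2 * K + 1) * M * (M + 1) * (F (k + 1) r)\<^sup>2) = (\<Sum>r\<le>m. G (Suc r) - G r)"
    by (rule sum.cong) (simp_all only: step atMost_iff)
  also have "\<dots> = 0"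
    unfolding lessThan_Suc_atMost[symmetric] sum_lessThan_telescope
    by (simp add: G_def N_def rfact_def)
  finally have eq: "(K + 1) ^ 3 * ((\<Sum>r\<le>m. (F (k + 2) r)\<^sup>2) - (\<Sum>r\<le>m. (F (k + 1) r)\<^sup>2)) -
      K ^ 3 * ((\<Sum>r\<le>m. (F (k + 1) r)\<^sup>2) - (\<Sum>r\<le>m. (F k r)\<^sup>2)) -
      2 * (2 * K + 1) * M * (M + 1) * (\<Sum>r\<le>m. (F (k + 1) r)\<^sup>2) = 0"
    by (simp only: sum_subtractf sum_distrib_left[symmetric])
  have "K + 1 = of_nat k + 2" "2 * K + 1 = 2 * of_nat k + 3"
    by (simp_all add: K_def)
  then show ?thesis
    using eq unfolding apery_op_def F_def[symmetric] K_def M_def by (simp only: right_minus_eq)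
qed


text \<open>Both sides satisfy the same second-order recurrence in k and agree at k = 0, with value
  1, and at k = 1, with value 2 m^2 + 2 m + 1.\<close>

lemma choose_sum_eq_lbin_sum:
  "(\<Sum>r\<le>m. (of_nat ((m choose r) * ((k + (m - r)) choose m)) :: 'a :: field_char_0)\<^sup>2) =
    (\<Sum>i\<le>m. lbin i (of_nat m) * lbin i (of_nat k))"
  (is "?f k = ?g k")
proof (induction k rule: induct_nat_012)
  case 0
  have "?f 0 = (\<Sum>r\<in>{0}. (of_nat ((m choose r) * ((0 + (m - r)) choose m)))\<^sup>2)"
    by (rule sum.mono_neutral_right) auto
  moreover have "?g 0 = (\<Sum>i\<in>{0}. lbin i (of_nat m) * lbin i (of_nat 0))"
    by (rule sum.mono_neutral_right) (auto simp: lbin_of_nat_eq_0[of 0, simplified])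
  ultimately show ?case by simp
next
  case 1
  have "?f 1 = (\<Sum>r\<in>{0..1} \<inter> {..m}. (of_nat ((m choose r) * ((1 + (m - r)) choose m)))\<^sup>2)"
    by (rule sum.mono_neutral_right) (auto simp: not_le)
  moreover have "?g 1 = (\<Sum>i\<in>{0..1} \<inter> {..m}. lbin i (of_nat m) * lbin i (of_nat 1))"
    by (rule sum.mono_neutral_right) (auto simp: not_le lbin_of_nat_eq_0[of 1, simplified])
  moreover have "{0..1} \<inter> {..m} = (if m = 0 then {0} else {0, 1})" by auto
  ultimately have "?f 1 = ?g 1"
    by (auto simp: lbin_def power2_eq_square algebra_simps)
  then show ?case by (simp only: One_nat_def)
next
  case (ge2 k)
  have "(of_nat k + 2 :: 'a) \<noteq> 0"
    by (metis of_nat_add of_nat_numeral of_nat_eq_0_iff add_is_0 zero_neq_numeral)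
  moreover have "apery_op ?f k = apery_op ?g k"
    unfolding apery_op_choose_sum apery_op_lbin_sum using ge2(2) by simp
  ultimately show ?case
    using ge2 unfolding apery_op_def by simp
qed

subsection \<open>Summation over both indices\<close>

lemma of_nat_odd_neq_0: "(of_nat (2 * i + 1) :: 'a :: semiring_char_0) \<noteq> 0"
  by (simp only: of_nat_eq_0_iff)

text \<open>The right side is an antidifference: its increment rests on (n - i) + (2 i + 1) = n + i
  + 1, and at n = 0 it vanishes through a negative argument of \<open>rfact\<close>.\<close>

lemma sum_lbin_of_nat:
  "of_nat (2 * i + 1) * (\<Sum>k<n. lbin i (of_nat k)) =
    fact (n + i) * rfact (int n - 1 - int i) * (rfact (int i) :: 'a :: field_char_0)\<^sup>2"
proof (induction n)
  case 0
  show ?case by (simp add: rfact_def)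
next
  case (Suc n)
  have e: "rfact (int n - 1 - int i) = (of_nat n - of_nat i) * (rfact (int n - int i) :: 'a)"
    by (rule rfact_dec) simp_all
  have "of_nat (2 * i + 1) * (\<Sum>k<Suc n. lbin i (of_nat k)) =
      fact (n + i) * rfact (int n - 1 - int i) * (rfact (int i))\<^sup>2 +
      of_nat (2 * i + 1) * (fact (n + i) * rfact (int n - int i) * (rfact (int i) :: 'a)\<^sup>2)"
    by (simp only: sum.lessThan_Suc distrib_left Suc.IH lbin_of_nat_rfact[of i n])
  also have "\<dots> = fact (Suc n + i) * rfact (int n - int i) * (rfact (int i))\<^sup>2"
    unfolding e by (simp add: algebra_simps)
  finally show ?case by simp
qed

lemma sum_lbin_of_nat':
  assumes "n > 0"
  shows "(\<Sum>k<n. lbin i (of_nat k)) =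
    (of_nat n / of_nat (2 * i + 1)) * (of_nat (((n - 1) choose i) * ((n + i) choose i)) :: 'a :: field_char_0)"
proof -
  from assms obtain n' where n: "n = Suc n'" by (cases n) auto
  have "fact n' * of_nat n * rfact (int n) = (1 :: 'a)"
  proof -
    have "fact n' * of_nat n = (fact n :: 'a)" by (simp add: n mult.commute)
    then show ?thesis by (simp add: rfact_def)
  qed
  then have "fact (n + i) * rfact (int n - 1 - int i) * (rfact (int i))\<^sup>2 =
      of_nat n * (of_nat (((n - 1) choose i) * ((n + i) choose i)) :: 'a)"
    unfolding of_nat_mult of_nat_choose_rfact by (simp add: n power2_eq_square mult.assoc mult.left_commute)
  then show ?thesis
    using of_nat_odd_neq_0[of i, where 'a = 'a] sum_lbin_of_nat[of i n, where 'a = 'a] by (simp add: field_simps del: of_nat_add of_nat_mult)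
qed

text \<open>The product of 2 m + 1 and \<open>S m\<close> does not depend on m, because its
  increment is a multiple of an (m + 1)-st difference of binom(m + i, m), a polynomial of degree m
  in i.\<close>

lemma alternating_lbin_sum:
  "(\<Sum>i\<le>m. (- 1) ^ i * lbin i (of_nat m) / of_nat (2 * i + 1)) = (1 / of_nat (2 * m + 1) :: 'a :: field_char_0)"
proof -
  define S :: "nat \<Rightarrow> 'a" where "S m = (\<Sum>i\<le>m. (- 1) ^ i * lbin i (of_nat m) / of_nat (2 * i + 1))" for m
  have step: "of_nat (2 * m + 3) * S (Suc m) = of_nat (2 * m + 1) * S m" for m
  proof -
    \<comment> \<open>Rests on (2 m + 3)(m + i + 1) - (2 m + 1)(m + 1 - i) = 2 (m + 1)(2 i + 1); the
      factor 2 i + 1 cancels the denominator of the summand.\<close>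
    have *: "of_nat (2 * m + 3) * lbin i (of_nat (Suc m)) - of_nat (2 * m + 1) * lbin i (of_nat m) =
        of_nat (2 * i + 1) * (2 * of_nat ((Suc m choose i) * ((m + i) choose m)) :: 'a)" for i
    proof -
      have e: "rfact (int m - int i) = (of_nat m + 1 - of_nat i) * (rfact (int (Suc m) - int i) :: 'a)"
        by (rule rfact_dec) simp_all
      have "int (m + i) - int m = int i" by simp
      then have "of_nat ((Suc m choose i) * ((m + i) choose m)) = fact (Suc m) * rfact (int m) *
          (fact (m + i) * rfact (int (Suc m) - int i) * (rfact (int i) :: 'a)\<^sup>2)"
        unfolding of_nat_mult of_nat_choose_rfact by (simp only: power2_eq_square ac_simps)
      moreover have "fact (Suc m) * rfact (int m) = (of_nat m + 1 :: 'a)"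
        by (simp add: rfact_def field_simps)
      ultimately have e': "of_nat ((Suc m choose i) * ((m + i) choose m)) =
          (of_nat m + 1) * (fact (m + i) * rfact (int (Suc m) - int i) * (rfact (int i) :: 'a)\<^sup>2)"
        by (simp only:)
      show ?thesis
        unfolding lbin_of_nat_rfact e' e by (simp add: algebra_simps)
    qed
    \<comment> \<open>The added term i = m + 1 is 0; it gives both sums the same range.\<close>
    have "S m = (\<Sum>i\<le>Suc m. (- 1) ^ i * lbin i (of_nat m) / of_nat (2 * i + 1))"
      by (simp add: S_def lbin_of_nat_eq_0)
    then have "of_nat (2 * m + 3) * S (Suc m) - of_nat (2 * m + 1) * S m =
       (\<Sum>i\<le>Suc m. (- 1) ^ i * (of_nat (2 * m + 3) * lbin i (of_nat (Suc m)) -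
         of_nat (2 * m + 1) * lbin i (of_nat m)) / of_nat (2 * i + 1))"
      unfolding S_def[of "Suc m"]
      by (simp only: sum_distrib_left sum_subtractf[symmetric])
        (simp add: right_diff_distrib diff_divide_distrib mult.left_commute del: of_nat_Suc of_nat_add of_nat_mult sum.atMost_Suc)
    also have "\<dots> = (\<Sum>i\<le>Suc m. 2 * (- 1) ^ (Suc m) *
        of_int ((- 1) ^ (Suc m + i) * int (Suc m choose i) * int ((m + i) choose m)))"
    proof (rule sum.cong)
      fix i
      show "(- 1) ^ i * (of_nat (2 * m + 3) * lbin i (of_nat (Suc m)) -
         of_nat (2 * m + 1) * lbin i (of_nat m)) / of_nat (2 * i + 1) = 2 * (- 1) ^ (Suc m) *
        (of_int ((- 1) ^ (Suc m + i) * int (Suc m choose i) * int ((m + i) choose m)) :: 'a)"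
        unfolding * using of_nat_odd_neq_0[of i, where 'a = 'a]
        by (simp add: power_add field_simps del: binomial_Suc_Suc)
    qed simp
    also have "\<dots> = 2 * (- 1) ^ (Suc m) *
        of_int (\<Sum>i\<le>Suc m. (- 1) ^ (Suc m + i) * int (Suc m choose i) * int ((m + i) choose m))"
      by (simp only: sum_distrib_left of_int_sum)
    also have "\<dots> = 0"
      by (simp only: alternating_choose_sum) simp
    finally show ?thesis by simp
  qed
  have "of_nat (2 * m + 1) * S m = 1"
  proof (induction m)
    case 0
    show ?case by (simp add: S_def)
  next
    case (Suc m)
    moreover have "2 * Suc m + 1 = 2 * m + 3" by simp
    ultimately show ?case using step by (simp only:)
  qed
  then show ?thesis
    unfolding S_def using of_nat_odd_neq_0 by (metis nonzero_mult_div_cancel_left)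
qed

text \<open>Both terms are expanded along \<open>lbin i m\<close>, the second by
  \<open>alternating_lbin_sum\<close>; only the deviation of the binomial product from (-1)^i is
  left.\<close>

lemma lbin_double_sum_minus:
  assumes "n > 0"
  shows "(\<Sum>k<n. \<Sum>i\<le>m. lbin i (of_nat m) * lbin i (of_nat k)) - of_nat n / of_nat (2 * m + 1) =
    (\<Sum>i\<le>m. lbin i (of_nat m) * ((of_nat n :: 'a :: field_char_0) / of_nat (2 * i + 1) *
       of_int (int (((n - 1) choose i) * ((n + i) choose i)) - (- 1) ^ i)))"
proof -
  have "(\<Sum>k<n. \<Sum>i\<le>m. lbin i (of_nat m) * lbin i (of_nat k)) =
      (\<Sum>i\<le>m. lbin i (of_nat m) * (\<Sum>k<n. lbin i (of_nat k :: 'a)))"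
    by (subst sum.swap) (simp only: sum_distrib_left)
  moreover have "of_nat n / of_nat (2 * m + 1) =
     (\<Sum>i\<le>m. of_nat n * ((- 1) ^ i * lbin i (of_nat m) / (of_nat (2 * i + 1) :: 'a)))"
    unfolding sum_distrib_left[symmetric] alternating_lbin_sum by simp
  ultimately show ?thesis
    unfolding sum_lbin_of_nat'[OF assms]
    by (simp add: sum_subtractf[symmetric] algebra_simps)
qed

subsection \<open>Congruences modulo powers of the prime\<close>

lemma bij_betw_of_nat_mod_ring:
  "bij_betw (of_nat :: nat \<Rightarrow> 'p :: prime_card mod_ring) {..<CARD('p)} UNIV"
proof -
  have "(of_nat :: nat \<Rightarrow> 'p mod_ring) ` {..<CARD('p)} = UNIV"
    using surj_of_nat_mod_ring[where 'a = 'p] by blast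
  moreover have "card {..<CARD('p)} = card (UNIV :: 'p mod_ring set)"
    by simp
  ultimately show ?thesis
    by (simp add: bij_betw_def eq_card_imp_inj_on)
qed

text \<open>Multiplication by 2 permutes the field, so the sum \<open>S\<close> satisfies \<open>4 * S = S\<close>.\<close>

lemma sum_inverse_squares_mod_ring:
  assumes "CARD('p :: prime_card) > 3"
  shows "(\<Sum>x\<in>UNIV. (inverse x :: 'p mod_ring)\<^sup>2) = 0"
proof -
  define S :: "'p mod_ring" where "S = (\<Sum>x\<in>UNIV. (inverse x)\<^sup>2)"
  have ndvd: "\<not> CARD('p) dvd 2" "\<not> CARD('p) dvd 3"
    using assms by (auto dest: dvd_imp_le)
  then have two: "(2 :: 'p mod_ring) \<noteq> 0" and three: "(3 :: 'p mod_ring) \<noteq> 0"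
    using of_nat_0_mod_ring_dvd[of 2, where 'a = 'p] of_nat_0_mod_ring_dvd[of 3, where 'a = 'p] by auto
  have "bij_betw (\<lambda>x :: 'p mod_ring. 2 * x) UNIV UNIV"
    by (rule bij_betwI[of _ _ _ "\<lambda>x. x / 2"]) (use two in auto)
  then have "S = (\<Sum>x\<in>UNIV. (inverse (2 * x :: 'p mod_ring))\<^sup>2)"
    unfolding S_def by (rule sum.reindex_bij_betw[symmetric])
  also have "\<dots> = (inverse 2)\<^sup>2 * S"
    by (simp only: S_def sum_distrib_left inverse_mult_distrib power_mult_distrib)
  finally have "2 ^ 2 * S = 2 ^ 2 * ((inverse 2)\<^sup>2 * S)"
    by (rule arg_cong)
  also have "\<dots> = (2 * inverse 2)\<^sup>2 * S"
    by (simp only: power_mult_distrib mult.assoc)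
  also have "\<dots> = S" using two by simp
  finally have "2 ^ 2 * S - S = 0" by (simp only: right_minus_eq)
  then have "3 * S = 0" by (simp add: algebra_simps)
  with three show ?thesis by (simp add: S_def)
qed

text \<open>Replacing r by p - r preserves the summand, so the full sum is twice the half sum; the
  term r = 0 contributes nothing as \<open>inverse 0 = 0\<close>.\<close>

lemma half_sum_inverse_squares_mod_ring:
  assumes "CARD('p :: prime_card) > 3" and h: "CARD('p) = 2 * h + 1"
  shows "(\<Sum>r=1..h. (inverse (of_nat r) :: 'p mod_ring)\<^sup>2) = 0"
proof -
  let ?f = "\<lambda>r. (inverse (of_nat r) :: 'p mod_ring)\<^sup>2"
  have "0 = (\<Sum>r<CARD('p). ?f r)"
    unfolding sum_inverse_squares_mod_ring[OF assms(1), symmetric]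
    by (rule sum.reindex_bij_betw[OF bij_betw_of_nat_mod_ring, symmetric])
  also have "{..<CARD('p)} = insert 0 ({1..h} \<union> {h + 1..2 * h})"
    unfolding h by auto
  also have "sum ?f \<dots> = sum ?f {1..h} + sum ?f {h + 1..2 * h}"
    by (subst sum.insert) (auto intro: sum.union_disjoint)
  also have "sum ?f {h + 1..2 * h} = sum ?f {1..h}"
  proof (rule sum.reindex_bij_witness[of _ "\<lambda>r. CARD('p) - r" "\<lambda>r. CARD('p) - r"])
    fix r assume "r \<in> {h + 1..2 * h}"
    then have "of_nat (CARD('p) - r) = (of_nat CARD('p) - of_nat r :: 'p mod_ring)"
      by (intro of_nat_diff) (simp add: h)
    then show "?f (CARD('p) - r) = ?f r" by simp
  qed (auto simp: h)
  finally have "of_nat 2 * sum ?f {1..h} = 0" by simp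
  moreover have "\<not> CARD('p) dvd 2"
    using assms by (auto dest: dvd_imp_le)
  then have "of_nat 2 \<noteq> (0 :: 'p mod_ring)"
    using of_nat_0_mod_ring_dvd[of 2, where 'a = 'p] by auto
  ultimately show ?thesis by simp
qed

text \<open>\<open>sqsum i\<close> is \<open>i!^2 * (\<Sum>r=1..i. 1 / r^2)\<close>, the second-order coefficient in \<open>prod_minus_squares\<close>.\<close>

primrec sqsum :: "nat \<Rightarrow> int" where
  "sqsum 0 = 0"
| "sqsum (Suc i) = (int (Suc i))\<^sup>2 * sqsum i + (fact i)\<^sup>2"

text \<open>The numbers 1, ..., i are invertible modulo p because i < p, so the recursion of
  \<open>sqsum\<close> may be divided by squares of factorials.\<close>

lemma of_int_sqsum:
  "i < CARD('p :: prime_card) \<Longrightarrow>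
    (of_int (sqsum i) :: 'p mod_ring) = (of_nat (fact i))\<^sup>2 * (\<Sum>r=1..i. (inverse (of_nat r))\<^sup>2)"
proof (induction i)
  case (Suc i)
  have "\<not> CARD('p) dvd Suc i"
    using Suc.prems by (auto dest: dvd_imp_le)
  then have "(of_nat (Suc i) :: 'p mod_ring) \<noteq> 0"
    using of_nat_0_mod_ring_dvd by blast
  moreover have "of_nat (fact (Suc i)) = (of_nat (Suc i) * of_nat (fact i) :: 'p mod_ring)"
    by (simp only: fact_Suc of_nat_mult of_nat_id)
  moreover have "of_int (sqsum (Suc i)) =
      ((of_nat (Suc i))\<^sup>2 * of_int (sqsum i) + (of_nat (fact i))\<^sup>2 :: 'p mod_ring)"
  proof -
    have "of_int (fact i) = (of_nat (fact i) :: 'p mod_ring)"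
      by (metis of_int_of_nat_eq of_nat_fact)
    then show ?thesis by (simp del: of_nat_Suc)
  qed
  moreover have "b\<^sup>2 * (a\<^sup>2 * s) + a\<^sup>2 = (b * a)\<^sup>2 * (s + (inverse b)\<^sup>2)"
    if "b \<noteq> 0" for a b s :: "'p mod_ring"
  proof -
    have "(b * a)\<^sup>2 * (s + (inverse b)\<^sup>2) = b\<^sup>2 * (a\<^sup>2 * s) + a\<^sup>2 * (b * inverse b)\<^sup>2"
      by (simp only: power_mult_distrib distrib_left ac_simps)
    with that show ?thesis by simp
  qed
  moreover have "(\<Sum>r=1..Suc i. (inverse (of_nat r :: 'p mod_ring))\<^sup>2) =
      (\<Sum>r=1..i. (inverse (of_nat r))\<^sup>2) + (inverse (of_nat (Suc i)))\<^sup>2"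
    by simp
  ultimately show ?case
    using Suc by (simp only: Suc_lessD)
qed simp

lemma dvd_sqsum:
  assumes "CARD('p :: prime_card) > 3" "CARD('p) = 2 * h + 1"
  shows "int CARD('p) dvd sqsum h"
proof -
  have "(of_int (sqsum h) :: 'p mod_ring) = 0"
    using half_sum_inverse_squares_mod_ring[OF assms] of_int_sqsum[of h, where 'p = 'p] assms by simp
  then show ?thesis
    by (simp add: of_int_eq_0_iff_char_dvd)
qed

section \<open>Expansion of binom(p - 1, i) binom(p + i, i) in powers of p^2\<close>

lemma prod_minus_squares:
  "\<exists>q. (\<Prod>r=1..i. P - (int r)\<^sup>2) = (- 1) ^ i * ((fact i)\<^sup>2 - P * sqsum i) + P\<^sup>2 * q"
proof (induction i)
  case (Suc i)
  then obtain q where q: "(\<Prod>r=1..i. P - (int r)\<^sup>2) = (- 1) ^ i * ((fact i)\<^sup>2 - P * sqsum i) + P\<^sup>2 * q"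
    by blast
  have "(\<Prod>r=1..Suc i. P - (int r)\<^sup>2) = (- 1) ^ Suc i * ((fact (Suc i))\<^sup>2 - P * sqsum (Suc i)) +
      P\<^sup>2 * (q * (P - (int (Suc i))\<^sup>2) - (- 1) ^ i * sqsum i)"
  proof -
    have "(\<Prod>r=1..Suc i. P - (int r)\<^sup>2) = (P - (int (Suc i))\<^sup>2) * (\<Prod>r=1..i. P - (int r)\<^sup>2)"
      by simp
    then show ?thesis
      unfolding q by (simp add: algebra_simps power2_eq_square)
  qed
  then show ?case by blast
qed (auto intro: exI[of _ 0])

text \<open>The factors n - r of i! binom(n - 1, i) pair with the factors n + r of i! binom(n + i,
  i).\<close>

lemma fact_sq_mult_choose:
  assumes "i < n"
  shows "(fact i)\<^sup>2 * int (((n - 1) choose i) * ((n + i) choose i)) = (\<Prod>r=1..i. (int n)\<^sup>2 - (int r)\<^sup>2)"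
  using assms
proof (induction i)
  case (Suc i)
  have 1: "int (Suc i) * int ((n - 1) choose Suc i) = (int n - int (Suc i)) * int ((n - 1) choose i)"
  proof -
    have "Suc i * ((n - 1) choose Suc i) = (n - 1 - i) * ((n - 1) choose i)"
      by (simp only: binomial_absorb_comp binomial_absorption)
    then have "int (Suc i) * int ((n - 1) choose Suc i) = int (n - 1 - i) * int ((n - 1) choose i)"
      by (metis of_nat_mult)
    also have "int (n - 1 - i) = int n - int (Suc i)" using Suc.prems by simp
    finally show ?thesis .
  qed
  have 2: "int (Suc i) * int ((n + Suc i) choose Suc i) = (int n + int (Suc i)) * int ((n + i) choose i)"
    using Suc_times_binomial[of i "n + i"] by (metis add_Suc_right of_nat_add of_nat_mult)
  have "(fact (Suc i))\<^sup>2 * int (((n - 1) choose Suc i) * ((n + Suc i) choose Suc i)) =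
      (fact i)\<^sup>2 * ((int (Suc i) * int ((n - 1) choose Suc i)) * (int (Suc i) * int ((n + Suc i) choose Suc i)))"
    by (simp add: power2_eq_square del: of_nat_Suc binomial_Suc_Suc)
  also have "\<dots> = ((fact i)\<^sup>2 * int (((n - 1) choose i) * ((n + i) choose i))) * ((int n)\<^sup>2 - (int (Suc i))\<^sup>2)"
    unfolding 1 2 by (simp add: power2_eq_square algebra_simps)
  also have "\<dots> = (\<Prod>r=1..Suc i. (int n)\<^sup>2 - (int r)\<^sup>2)"
    using Suc by (simp add: prod.nat_ivl_Suc' mult.commute)
  finally show ?case .
qed simp

text \<open>By \<open>prod_minus_squares\<close> at P = p^2, the difference times i!^2 is -(-1)^i
  p^2 \<open>sqsum i\<close> modulo p^4, and i! is prime to p. For p = 2 i + 1 the term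
  \<open>sqsum i\<close> supplies another factor p.\<close>

lemma choose_product_cong:
  fixes i :: nat
  defines "p \<equiv> CARD('p :: prime_card)"
  assumes "p > 3" "i < p"
  shows "int p ^ 2 dvd int (((p - 1) choose i) * ((p + i) choose i)) - (- 1) ^ i" (is ?A)
    and "p = 2 * i + 1 \<Longrightarrow> int p ^ 3 dvd int (((p - 1) choose i) * ((p + i) choose i)) - (- 1) ^ i"
proof -
  let ?C = "int (((p - 1) choose i) * ((p + i) choose i)) - (- 1) ^ i"
  have prime: "prime p" unfolding p_def by (rule prime_card)
  obtain q where "(fact i)\<^sup>2 * int (((p - 1) choose i) * ((p + i) choose i)) =
      (- 1) ^ i * ((fact i)\<^sup>2 - int p ^ 2 * sqsum i) + (int p ^ 2)\<^sup>2 * q"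
    using prod_minus_squares[of "int p ^ 2" i] fact_sq_mult_choose[OF assms(3)] by auto
  then have eq: "(fact i)\<^sup>2 * ?C = int p ^ 2 * (int p ^ 2 * q - (- 1) ^ i * sqsum i)"
    by (simp add: algebra_simps power2_eq_square)
  have "\<not> p dvd fact i"
    using prime assms(3) by (simp add: prime_dvd_fact_iff)
  then have "coprime (int p) (fact i)"
    using prime by (metis coprime_int_iff of_nat_fact prime_imp_coprime)
  then have cop: "coprime (int p ^ k) ((fact i)\<^sup>2)" for k
    by simp
  have "int p ^ 2 dvd (fact i)\<^sup>2 * ?C" unfolding eq by simp
  then show ?A
    using cop[of 2] coprime_dvd_mult_right_iff by blast
  assume "p = 2 * i + 1"
  then have "int p dvd sqsum i"
    using dvd_sqsum[of i, where 'p = 'p] assms by simp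
  then have "int p dvd int p ^ 2 * q - (- 1) ^ i * sqsum i"
    by simp
  then have "int p ^ 2 * int p dvd (fact i)\<^sup>2 * ?C"
    unfolding eq by (rule mult_dvd_mono[OF dvd_refl])
  then have "int p ^ 3 dvd (fact i)\<^sup>2 * ?C"
    by (simp add: power2_eq_square power3_eq_cube)
  then show "int p ^ 3 dvd ?C"
    using cop[of 3] coprime_dvd_mult_right_iff by blast
qed

text \<open>The prime divides (a + b)! but neither a! nor b!.\<close>

lemma prime_dvd_choose_add:
  fixes p :: nat
  assumes "prime p" "a < p" "b < p" "p \<le> a + b"
  shows "p dvd (a + b) choose a"
proof -
  have "p dvd fact (a + b)"
    using assms by (simp add: prime_dvd_fact_iff)
  also have "fact (a + b) = fact a * fact b * ((a + b) choose a)"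
    using binomial_fact_lemma[of a "a + b"] by simp
  finally show ?thesis
    using assms by (simp add: prime_dvd_mult_iff prime_dvd_fact_iff)
qed

subsection \<open>Integrality in the p-adic numbers\<close>

lemma padic_ints_0 [simp]: "0 \<in> padic_ints"
  and padic_ints_1 [simp]: "1 \<in> padic_ints"
  unfolding padic_ints_def by (metis rangeI to_fract_0, metis rangeI to_fract_1)

lemma padic_ints_add: "a \<in> padic_ints \<Longrightarrow> b \<in> padic_ints \<Longrightarrow> a + b \<in> padic_ints"
  by (auto simp: padic_ints_def simp flip: to_fract_add)

lemma padic_ints_diff: "a \<in> padic_ints \<Longrightarrow> b \<in> padic_ints \<Longrightarrow> a - b \<in> padic_ints"
  by (auto simp: padic_ints_def simp flip: to_fract_diff)

lemma padic_ints_mult: "a \<in> padic_ints \<Longrightarrow> b \<in> padic_ints \<Longrightarrow> a * b \<in> padic_ints"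
  by (auto simp: padic_ints_def simp flip: to_fract_mult)

lemma padic_ints_sum: "(\<And>i. i \<in> A \<Longrightarrow> f i \<in> padic_ints) \<Longrightarrow> sum f A \<in> padic_ints"
  by (induction A rule: infinite_finite_induct) (auto intro: padic_ints_add)

lemma padic_ints_of_nat: "of_nat n \<in> padic_ints"
  by (induction n) (auto intro: padic_ints_add)

lemma padic_ints_of_int: "of_int n \<in> padic_ints"
  by (cases n rule: int_diff_cases) (auto intro: padic_ints_diff padic_ints_of_nat)

lemma to_fract_of_nat: "to_fract (of_nat n) = of_nat n"
  by (simp add: to_fract_def of_nat_fract)

text \<open>An inverse of q exists modulo every p^n, and these inverses are compatible because each
  is unique modulo p^n.\<close>

lemma padic_int_unit:
  assumes "coprime q CARD('p :: prime_card)"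
  shows "\<exists>w :: 'p padic_int. of_nat q * w = 1"
proof -
  let ?p = "int CARD('p)"
  have cop: "coprime (int q) (?p ^ n)" for n
    using assms by simp
  have "\<exists>x. [int q * x = 1] (mod ?p ^ n)" for n
    using cop by (rule cong_solve_coprime_int)
  then obtain g where g: "\<And>n. [int q * g n = 1] (mod ?p ^ n)" by metis
  have comp: "[g (Suc n) = g n] (mod ?p ^ n)" for n
  proof -
    have "[int q * g (Suc n) = 1] (mod ?p ^ n)"
      using g[of "Suc n"] by (rule cong_dvd_modulus) simp
    then have "[int q * g (Suc n) = int q * g n] (mod ?p ^ n)"
      using g[of n] by (metis cong_sym cong_trans)
    then show ?thesis
      using cop by (simp add: cong_mult_lcancel)
  qed
  define w :: "'p padic_int" where "w = Abs_padic_int (\<lambda>n. g n mod ?p ^ n)"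
  have "padic_residue w = (\<lambda>n. g n mod ?p ^ n)"
    unfolding w_def by (rule Abs_padic_int_inverse) (use padic_residues_of_int[of g, OF comp] in blast)
  then have "of_nat q * w = 1"
    using g by (intro padic_int_eqI) (simp add: padic_residue_simps padic_residue_of_nat mod_simps cong_def)
  then show ?thesis by blast
qed

lemma padic_ints_inverse_of_nat:
  assumes "coprime q CARD('p :: prime_card)"
  shows "inverse (of_nat q :: 'p padic) \<in> padic_ints"
proof -
  obtain w :: "'p padic_int" where "of_nat q * w = 1"
    using padic_int_unit[OF assms] by blast
  then have "of_nat q * to_fract w = 1"
    by (metis to_fract_mult to_fract_of_nat to_fract_1)
  then have "inverse (of_nat q) = to_fract w"
    by (rule inverse_unique)
  then show ?thesis
    by (simp add: padic_ints_def)
qed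

text \<open>\<open>N\<close> is the residue modulo p^n, and \<open>w\<close> has the remaining
  digits, shifted down by n places.\<close>

lemma padic_int_approx:
  fixes z :: "'p :: prime_card padic_int"
  shows "\<exists>N w. z = of_nat N + of_nat (CARD('p) ^ n) * w"
proof -
  let ?p = "int CARD('p)" and ?r = "padic_residue z"
  define w :: "'p padic_int" where "w = Abs_padic_int (\<lambda>m. ?r (m + n) div ?p ^ n)"
  have rng: "0 \<le> ?r m" "?r m < ?p ^ m" for m
    using padic_residue[of z] by auto
  have "?r (m + n) div ?p ^ n \<in> {0..<?p ^ m} \<and>
     ?r (Suc m + n) div ?p ^ n mod ?p ^ m = ?r (m + n) div ?p ^ n" for m
  proof
    have "?r (m + n) div ?p ^ n * ?p ^ n \<le> ?r (m + n)"
      using rng(1)[of "m + n"] by (simp add: minus_mod_eq_div_mult[symmetric])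
    also have "\<dots> < ?p ^ m * ?p ^ n"
      using rng(2)[of "m + n"] by (simp add: power_add)
    finally show "?r (m + n) div ?p ^ n \<in> {0..<?p ^ m}"
      using rng(1)[of "m + n"] by (simp add: pos_imp_zdiv_nonneg_iff)
    have "?r (m + n) = ?r (Suc m + n) mod (?p ^ n * ?p ^ m)"
      using padic_residue_Suc_mod[of z "m + n"] by (simp add: power_add mult.commute)
    then have "?r (m + n) = ?p ^ n * (?r (Suc m + n) div ?p ^ n mod ?p ^ m) + ?r (Suc m + n) mod ?p ^ n"
      by (simp only: zmod_zmult2_eq[of "?p ^ m"] padic_card_gt_0 less_imp_le)
    then show "?r (Suc m + n) div ?p ^ n mod ?p ^ m = ?r (m + n) div ?p ^ n"
      using padic_card_gt_0[of n, where 'p = 'p] by (simp add: div_add1_eq)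
  qed
  then have w: "padic_residue w = (\<lambda>m. ?r (m + n) div ?p ^ n)"
    unfolding w_def by (intro Abs_padic_int_inverse) blast
  obtain N where N: "?r n = int N"
    using rng(1)[of n] by (rule nonneg_int_cases)
  have "z = of_nat N + of_nat (CARD('p) ^ n) * w"
  proof (rule padic_int_eqI)
    fix m
    have "padic_residue (of_nat N + of_nat (CARD('p) ^ n) * w) m =
        (int N + int (CARD('p) ^ n) * (?r (m + n) div ?p ^ n)) mod ?p ^ m"
      by (simp add: padic_residue_simps padic_residue_of_nat mod_simps w del: of_nat_power)
    also have "int N = ?r (m + n) mod ?p ^ n"
      using padic_residue_add_mod[of z n m] N by (simp add: add.commute)
    also have "?r (m + n) mod ?p ^ n + int (CARD('p) ^ n) * (?r (m + n) div ?p ^ n) = ?r (m + n)"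
      by simp
    also have "\<dots> mod ?p ^ m = ?r m"
      by (rule padic_residue_add_mod)
    finally show "?r m = padic_residue (of_nat N + of_nat (CARD('p) ^ n) * w) m" by simp
  qed
  then show ?thesis by blast
qed

text \<open>Serves to replace a p-adic argument of a falling factorial by a natural number congruent
  to it modulo c.\<close>

lemma prod_add_multiple:
  fixes a c w :: "'a :: comm_ring_1"
  shows "\<exists>u. (\<Prod>i=0..<k. a + c * w - of_nat i) = (\<Prod>i=0..<k. a - of_nat i) + c * u"
proof (induction k)
  case (Suc k)
  then obtain u where u: "(\<Prod>i=0..<k. a + c * w - of_nat i) = (\<Prod>i=0..<k. a - of_nat i) + c * u"
    by blast
  have "(\<Prod>i=0..<Suc k. a + c * w - of_nat i) = (\<Prod>i=0..<Suc k. a - of_nat i) +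
      c * (u * (a + c * w - of_nat k) + w * (\<Prod>i=0..<k. a - of_nat i))"
    using u by (simp add: algebra_simps)
  then show ?case by blast
qed (auto intro: exI[of _ 0])

text \<open>Write k! = p^v q with q prime to p, and choose a natural number N congruent to x modulo
  p^v. The falling factorials of x and N differ by a multiple of p^v, and that of N is k! binom(N,
  k); after division by p^v only the unit q remains to be inverted.\<close>

lemma padic_ints_gchoose:
  assumes "x \<in> padic_ints"
  shows "(x :: 'p :: prime_card padic) gchoose k \<in> padic_ints"
proof -
  have prime: "prime CARD('p)" by (rule prime_card)
  obtain z where z: "x = to_fract z" using assms by (auto simp: padic_ints_def)
  have "\<not> is_unit CARD('p)" using prime not_prime_unit by blast
  then obtain v q where q: "fact k = CARD('p) ^ v * q" "\<not> CARD('p) dvd q"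
    using multiplicity_decompose'[of "fact k" "CARD('p)"] by (metis fact_nonzero)
  have cop: "coprime q CARD('p)"
    using q(2) prime by (metis coprime_commute prime_imp_coprime)
  let ?P = "of_nat (CARD('p) ^ v) :: 'p padic"
  obtain N w where "z = of_nat N + of_nat (CARD('p) ^ v) * w"
    using padic_int_approx by blast
  obtain u' where "(\<Prod>i=0..<k. z - of_nat i) = (\<Prod>i=0..<k. of_nat N - of_nat i) + of_nat (CARD('p) ^ v) * u'"
    using prod_add_multiple[of "of_nat N" _ w k] \<open>z = _\<close> by blast
  then have "to_fract (\<Prod>i=0..<k. z - of_nat i) = to_fract (\<Prod>i=0..<k. of_nat N - of_nat i) + ?P * to_fract u'"
    by (simp only: to_fract_add to_fract_mult to_fract_of_nat)
  moreover have "to_fract (\<Prod>i\<in>A. y - of_nat i) = (\<Prod>i\<in>A. to_fract y - of_nat i)" for y :: "'p padic_int" and A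
    by (induction A rule: infinite_finite_induct) (simp_all add: to_fract_mult to_fract_diff to_fract_of_nat)
  ultimately have prod: "(\<Prod>i=0..<k. x - of_nat i) = (\<Prod>i=0..<k. of_nat N - of_nat i) + ?P * to_fract u'"
    by (simp add: z to_fract_of_nat)
  have "fact k * (x gchoose k) = fact k * of_nat (N choose k) + ?P * to_fract u'"
    unfolding gbinomial_mult_fact prod binomial_gbinomial ..
  moreover have "fact k = ?P * of_nat q"
    using q(1) by (metis of_nat_fact of_nat_mult)
  ultimately have "?P * (of_nat q * (x gchoose k)) = ?P * (of_nat q * of_nat (N choose k) + to_fract u')"
    by (simp only: distrib_left mult.assoc)
  moreover have "?P \<noteq> 0" by simp
  ultimately have eq: "of_nat q * (x gchoose k) = of_nat q * of_nat (N choose k) + to_fract u'"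
    by (metis mult_left_cancel)
  have "q \<noteq> 0" using q(2) by (metis dvd_0_right)
  then have "x gchoose k = inverse (of_nat q) * (of_nat q * (x gchoose k))"
    by simp
  also have "\<dots> \<in> padic_ints"
    unfolding eq
    by (intro padic_ints_mult padic_ints_add padic_ints_inverse_of_nat padic_ints_of_nat cop)
      (simp add: padic_ints_def)
  finally show ?thesis .
qed

subsection \<open>Comparison of coefficients\<close>

text \<open>This is \<open>D m\<close> of the overview, with a natural number n in place of
  p.\<close>

definition lin_coeff :: "nat \<Rightarrow> nat \<Rightarrow> int" where
  "lin_coeff n m = (\<Sum>k<n. \<Sum>i<n. \<Sum>j<n. (- 1) ^ j *
     int ((k choose i) * ((k + j) choose j) * (((i + j) choose m) * (m choose i) * (m choose j))))"

lemma gchoose_mult_gchoose_neg: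
  "(x gchoose j) * ((- 1 - x) gchoose j) = (- 1) ^ j * lbin j (x :: 'a :: field_char_0)"
proof -
  have "(- 1 - x) gchoose j = (- 1) ^ j * ((x + of_nat j) gchoose j)"
    by (subst gbinomial_negated_upper) (simp add: algebra_simps)
  then show ?thesis by (simp add: lbin_def)
qed

text \<open>The range of i no longer depends on k, which allows the sums to be interchanged.\<close>

lemma s_poly_lbin: "k < n \<Longrightarrow> s_poly k x = (\<Sum>i<n. of_nat (k choose i) * lbin i x)"
  unfolding s_poly_def lbin_def mult.assoc
  by (rule sum.mono_neutral_left) (auto simp: not_le)

text \<open>Products are linearised by \<open>lbin_mult\<close>. As i + j < 2 n, the range m < 2 n
  serves all pairs, the surplus coefficients being 0.\<close>

lemma sum_s_poly_expand:
  fixes x :: "'a :: field_char_0"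
  shows "(\<Sum>k<n. s_poly k x * (\<Sum>j<n. (x gchoose j) * ((- 1 - x) gchoose j) * of_nat ((k + j) choose j))) =
    (\<Sum>m<2 * n. of_int (lin_coeff n m) * lbin m x)"
proof -
  define c :: "nat \<Rightarrow> nat \<Rightarrow> nat \<Rightarrow> 'a"
    where "c i j m = of_nat (((i + j) choose m) * (m choose i) * (m choose j))" for i j m
  define d :: "nat \<Rightarrow> nat \<Rightarrow> nat \<Rightarrow> 'a"
    where "d k i j = (- 1) ^ j * of_nat ((k choose i) * ((k + j) choose j))" for k i j
  have lin: "lbin i x * lbin j x = (\<Sum>m<2 * n. c i j m * lbin m x)" if "i < n" "j < n" for i j
    unfolding lbin_mult c_def
    by (rule sum.mono_neutral_left) (use that in \<open>auto simp: not_le\<close>)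
  have "(\<Sum>k<n. s_poly k x * (\<Sum>j<n. (x gchoose j) * ((- 1 - x) gchoose j) * of_nat ((k + j) choose j))) =
     (\<Sum>k<n. \<Sum>i<n. \<Sum>j<n. d k i j * (lbin i x * lbin j x))"
  proof (rule sum.cong)
    fix k assume "k \<in> {..<n}"
    then show "s_poly k x * (\<Sum>j<n. (x gchoose j) * ((- 1 - x) gchoose j) * of_nat ((k + j) choose j)) =
      (\<Sum>i<n. \<Sum>j<n. d k i j * (lbin i x * lbin j x))"
      by (simp add: s_poly_lbin[of k n] sum_product gchoose_mult_gchoose_neg d_def ac_simps)
  qed simp
  also have "\<dots> = (\<Sum>k<n. \<Sum>i<n. \<Sum>j<n. \<Sum>m<2 * n. d k i j * c i j m * lbin m x)"
    by (intro sum.cong refl) (simp add: lin sum_distrib_left mult.assoc)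
  also have "\<dots> = (\<Sum>k<n. \<Sum>i<n. \<Sum>m<2 * n. \<Sum>j<n. d k i j * c i j m * lbin m x)"
    by (intro sum.cong refl sum.swap)
  also have "\<dots> = (\<Sum>k<n. \<Sum>m<2 * n. \<Sum>i<n. \<Sum>j<n. d k i j * c i j m * lbin m x)"
    by (intro sum.cong refl sum.swap)
  also have "\<dots> = (\<Sum>m<2 * n. \<Sum>k<n. \<Sum>i<n. \<Sum>j<n. d k i j * c i j m * lbin m x)"
    by (rule sum.swap)
  also have "\<dots> = (\<Sum>m<2 * n. of_int (lin_coeff n m) * lbin m x)"
    unfolding lin_coeff_def of_int_sum sum_distrib_right
    by (intro sum.cong refl) (simp add: c_def d_def)
  finally show ?thesis .
qed

text \<open>The factors binom(m, i) and binom(m, j) cut the ranges of i and j down to m, so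
  \<open>alternating_double_sum\<close> applies for each k.\<close>

lemma lin_coeff_below:
  assumes "m < n"
  shows "of_int ((- 1) ^ m * lin_coeff n m) =
    (\<Sum>k<n. \<Sum>i\<le>m. lbin i (of_nat m) * (lbin i (of_nat k) :: 'a :: field_char_0))"
proof -
  define e where "e k i j = (- 1) ^ (m + j) *
      int ((k choose i) * ((k + j) choose j) * (((i + j) choose m) * (m choose i) * (m choose j)))" for k i j
  have e_eq_0: "e k i j = 0" if "m < i \<or> m < j" for k i j
    using that by (auto simp: e_def binomial_eq_0)
  have "(- 1) ^ m * lin_coeff n m = (\<Sum>k<n. \<Sum>i<n. \<Sum>j<n. e k i j)"
    unfolding lin_coeff_def e_def sum_distrib_left by (simp add: power_add mult.assoc)
  also have "\<dots> = (\<Sum>k<n. \<Sum>i\<le>m. \<Sum>j\<le>m. e k i j)"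
  proof (rule sum.cong)
    fix k
    have "(\<Sum>i<n. \<Sum>j<n. e k i j) = (\<Sum>i\<le>m. \<Sum>j<n. e k i j)"
      by (rule sum.mono_neutral_right) (use assms in \<open>auto intro!: sum.neutral e_eq_0\<close>)
    also have "\<dots> = (\<Sum>i\<le>m. \<Sum>j\<le>m. e k i j)"
      by (intro sum.cong refl sum.mono_neutral_right) (use assms in \<open>auto intro!: sum.neutral e_eq_0\<close>)
    finally show "(\<Sum>i<n. \<Sum>j<n. e k i j) = (\<Sum>i\<le>m. \<Sum>j\<le>m. e k i j)" .
  qed simp
  also have "\<dots> = (\<Sum>k<n. \<Sum>r\<le>m. (int ((m choose r) * ((k + (m - r)) choose m)))\<^sup>2)"
    unfolding e_def alternating_double_sum ..
  finally have "(of_int ((- 1) ^ m * lin_coeff n m) :: 'a) =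
      of_int (\<Sum>k<n. \<Sum>r\<le>m. (int ((m choose r) * ((k + (m - r)) choose m)))\<^sup>2)"
    by (simp only:)
  also have "\<dots> = (\<Sum>k<n. \<Sum>r\<le>m. (of_nat ((m choose r) * ((k + (m - r)) choose m)) :: 'a)\<^sup>2)"
    by (simp only: of_int_sum of_int_power of_int_of_nat_eq)
  finally show ?thesis
    unfolding choose_sum_eq_lbin_sum .
qed

text \<open>In a non-zero summand p \<le> m \<le> i + j \<le> k + j, so binom(m, i), binom(m, j) and
  binom(k + j, j) each split a number that is at least p into two parts below p.\<close>

lemma prime_cube_dvd_lin_coeff:
  assumes "prime p" "p \<le> m"
  shows "int p ^ 3 dvd lin_coeff p m"
  unfolding lin_coeff_def
proof (intro dvd_sum dvd_mult)
  fix k i j assume "k \<in> {..<p}" "i \<in> {..<p}" "j \<in> {..<p}"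
  then have lt: "k < p" "i < p" "j < p" by simp_all
  have "p ^ 3 dvd (k choose i) * ((k + j) choose j) * (((i + j) choose m) * (m choose i) * (m choose j))"
  proof (cases "i \<le> k \<and> m \<le> i + j \<and> i \<le> m \<and> j \<le> m")
    case True
    have "p dvd (m choose i)" "p dvd (m choose j)" "p dvd ((k + j) choose j)"
      using prime_dvd_choose_add[OF assms(1), of i "m - i"] prime_dvd_choose_add[OF assms(1), of j "m - j"]
        prime_dvd_choose_add[OF assms(1), of j k] True lt assms(2)
      by (auto simp: add.commute)
    then have "p * p * p dvd (m choose i) * (m choose j) * ((k + j) choose j)"
      by (intro mult_dvd_mono)
    then have "p ^ 3 dvd (m choose i) * (m choose j) * ((k + j) choose j)"
      by (simp add: power3_eq_cube mult.assoc)
    then have "p ^ 3 dvd (m choose i) * (m choose j) * ((k + j) choose j) * ((k choose i) * ((i + j) choose m))"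
      by (rule dvd_mult2)
    then show ?thesis by (simp only: ac_simps)
  qed (auto simp: not_le binomial_eq_0)
  then show "int p ^ 3 dvd int ((k choose i) * ((k + j) choose j) *
      (((i + j) choose m) * (m choose i) * (m choose j)))"
    by (metis of_nat_dvd_iff of_nat_power)
qed

section \<open>Integrality of the coefficient differences after division by p^3\<close>

lemma dvd_imp_padic_ints_divide:
  assumes "int q dvd c" "q > 0"
  shows "of_int c / (of_nat q :: 'p :: prime_card padic) \<in> padic_ints"
proof -
  from assms(1) obtain d where "c = int q * d" by (elim dvdE)
  then have "of_int c / (of_nat q :: 'p padic) = of_int d"
    using assms(2) by simp
  then show ?thesis by (simp add: padic_ints_of_int)
qed

text \<open>If 2 i + 1 = p, the fraction is 1 and the congruence modulo p^3 is needed. Otherwise 2 i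
  + 1 is a unit, and the factor p complements the congruence modulo p^2.\<close>

lemma padic_ints_choose_product_term:
  fixes i :: nat
  defines "p \<equiv> CARD('p :: prime_card)"
  assumes "p > 3" "i < p"
  shows "of_nat p / of_nat (2 * i + 1) * of_int (int (((p - 1) choose i) * ((p + i) choose i)) - (- 1) ^ i) /
    (of_nat p ^ 3 :: 'p padic) \<in> padic_ints"
proof -
  define c where "c = int (((p - 1) choose i) * ((p + i) choose i)) - (- 1) ^ i"
  have prime: "prime p" unfolding p_def by (rule prime_card)
  show ?thesis
  proof (cases "p = 2 * i + 1")
    case True
    then have "int (p ^ 3) dvd c"
      using choose_product_cong(2)[of i, where 'p = 'p] assms unfolding c_def by simp
    then have "of_int c / (of_nat (p ^ 3) :: 'p padic) \<in> padic_ints"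
      by (rule dvd_imp_padic_ints_divide) (use assms(2) in simp)
    moreover have "(of_nat p :: 'p padic) / of_nat (2 * i + 1) = 1"
      unfolding True[symmetric] using assms(2) by simp
    ultimately show ?thesis unfolding c_def by simp
  next
    case False
    have "\<not> p dvd 2 * i + 1"
    proof
      assume "p dvd 2 * i + 1"
      then obtain k where k: "2 * i + 1 = p * k" by (elim dvdE)
      \<comment> \<open>As 2 i + 1 < 2 p, the only possible multiple is p itself, the excluded
        case.\<close>
      then have "p * k < p * 2" unfolding k[symmetric] using assms(3) by linarith
      then have "k < 2" by simp
      with k False show False by (auto simp: less_2_cases_iff)
    qed
    then have "coprime (2 * i + 1) p"
      using prime by (metis coprime_commute prime_imp_coprime)
    then have "inverse (of_nat (2 * i + 1) :: 'p padic) \<in> padic_ints"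
      unfolding p_def by (rule padic_ints_inverse_of_nat)
    moreover have "int (p ^ 2) dvd c"
      using choose_product_cong(1)[of i, where 'p = 'p] assms unfolding c_def by simp
    then have "of_int c / (of_nat (p ^ 2) :: 'p padic) \<in> padic_ints"
      by (rule dvd_imp_padic_ints_divide) (use assms(2) in simp)
    ultimately have "inverse (of_nat (2 * i + 1)) * (of_int c / (of_nat (p ^ 2) :: 'p padic)) \<in> padic_ints"
      by (rule padic_ints_mult)
    moreover have "of_nat p / of_nat (2 * i + 1) * of_int c / (of_nat p ^ 3 :: 'p padic) =
        inverse (of_nat (2 * i + 1)) * (of_int c / (of_nat (p ^ 2) :: 'p padic))"
    proof -
      have "a / q * d / a ^ 3 = inverse q * (d / a ^ 2)" if "a \<noteq> 0" for a q d :: "'p padic"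
        using that by (simp add: power2_eq_square power3_eq_cube divide_inverse)
      then show ?thesis using assms(2) by (simp only: of_nat_power) simp
    qed
    ultimately show ?thesis unfolding c_def by simp
  qed
qed

lemma padic_ints_lbin: "x \<in> padic_ints \<Longrightarrow> lbin i x \<in> padic_ints"
  unfolding lbin_def by (intro padic_ints_mult padic_ints_gchoose padic_ints_add padic_ints_of_nat)

text \<open>Up to the sign (-1)^m the difference is a combination of the terms in
  \<open>padic_ints_choose_product_term\<close> with integral coefficients
  \<open>lbin i m\<close>.\<close>

lemma lin_coeff_below_cong:
  fixes m :: nat
  defines "p \<equiv> CARD('p :: prime_card)"
  assumes "p > 3" "m < p"
  shows "(of_int (lin_coeff p m) - (- 1) ^ m * (of_nat p / of_nat (2 * m + 1))) / (of_nat p ^ 3 :: 'p padic)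
    \<in> padic_ints"
proof -
  let ?P = "of_nat p :: 'p padic"
  have "(of_int ((- 1) ^ m * lin_coeff p m) - ?P / of_nat (2 * m + 1)) / ?P ^ 3 =
     (\<Sum>i\<le>m. lbin i (of_nat m) * (?P / of_nat (2 * i + 1) *
       of_int (int (((p - 1) choose i) * ((p + i) choose i)) - (- 1) ^ i) / ?P ^ 3))"
    unfolding lin_coeff_below[OF assms(3)] using assms(2)
    by (subst lbin_double_sum_minus) (simp_all only: sum_divide_distrib times_divide_eq_right)
  also have "\<dots> \<in> padic_ints"
    unfolding p_def
    by (intro padic_ints_sum padic_ints_mult padic_ints_lbin padic_ints_of_nat
        padic_ints_choose_product_term) (use assms in auto)
  finally have "(- 1) ^ m * ((of_int ((- 1) ^ m * lin_coeff p m) - ?P / of_nat (2 * m + 1)) / ?P ^ 3) \<in> padic_ints"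
    by (rule padic_ints_mult[OF padic_ints_of_int[of "(- 1) ^ m", unfolded of_int_power of_int_minus of_int_1]])
  also have "(- 1) ^ m * ((of_int ((- 1) ^ m * lin_coeff p m) - ?P / of_nat (2 * m + 1)) / ?P ^ 3) =
     (of_int (lin_coeff p m) - (- 1) ^ m * (?P / of_nat (2 * m + 1))) / ?P ^ 3"
  proof -
    have "(- 1 :: 'p padic) ^ m * (- 1) ^ m = 1" by (simp flip: power_add)
    then show ?thesis
      by (simp add: right_diff_distrib flip: mult.assoc)
  qed
  finally show ?thesis .
qed

theorem theorem5p1:
  fixes p :: nat and x :: "'p :: prime_card padic"
  assumes "p = CARD('p)" and "p > 3" and "x \<in> padic_ints"
  shows "[(\<Sum>k=0..p-1. s_poly k x *
             (\<Sum>j=0..p-1. (x gchoose j) * ((- 1 - x) gchoose j) * of_nat ((k + j) choose j)))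
        = (\<Sum>k=0..p-1. (x gchoose k) * ((- 1 - x) gchoose k) * (of_nat p / of_nat (2 * k + 1)))]
         (pmod (of_nat p ^ 3))"
proof -
  let ?P = "of_nat p :: 'p padic"
  \<comment> \<open>The right-hand coefficients, extended by 0 to p \<le> m < 2 p so as to match the
    range in \<open>sum_s_poly_expand\<close>.\<close>
  let ?R = "\<lambda>m. if m < p then (- 1) ^ m * (?P / of_nat (2 * m + 1)) else 0"
  have prime: "prime p" unfolding assms(1) by (rule prime_card)
  have set: "{0..p - 1} = {..<p}" using assms(2) by auto
  have "(\<Sum>k<p. (x gchoose k) * ((- 1 - x) gchoose k) * (?P / of_nat (2 * k + 1))) =
      (\<Sum>m<2 * p. ?R m * lbin m x)"
    by (rule sum.mono_neutral_cong_left) (auto simp: gchoose_mult_gchoose_neg)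
  then have "((\<Sum>k=0..p-1. s_poly k x *
             (\<Sum>j=0..p-1. (x gchoose j) * ((- 1 - x) gchoose j) * of_nat ((k + j) choose j))) -
         (\<Sum>k=0..p-1. (x gchoose k) * ((- 1 - x) gchoose k) * (?P / of_nat (2 * k + 1)))) / ?P ^ 3 =
     (\<Sum>m<2 * p. (of_int (lin_coeff p m) - ?R m) / ?P ^ 3 * lbin m x)"
    unfolding set sum_s_poly_expand
    by (simp only: sum_subtractf[symmetric] sum_divide_distrib left_diff_distrib diff_divide_distrib
        times_divide_eq_left)
  also have "\<dots> \<in> padic_ints"
  proof (intro padic_ints_sum padic_ints_mult padic_ints_lbin assms(3))
    fix m
    show "(of_int (lin_coeff p m) - ?R m) / ?P ^ 3 \<in> padic_ints"
    proof (cases "m < p")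
      case True
      then show ?thesis
        using lin_coeff_below_cong[of m, where 'p = 'p] assms by simp
    next
      case False
      then have "int (p ^ 3) dvd lin_coeff p m"
        using prime_cube_dvd_lin_coeff[OF prime, of m] by simp
      then have "of_int (lin_coeff p m) / (of_nat (p ^ 3) :: 'p padic) \<in> padic_ints"
        by (rule dvd_imp_padic_ints_divide) (use assms(2) in simp)
      with False show ?thesis by simp
    qed
  qed
  finally show ?thesis unfolding padic_cong_def .
qed

end
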